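(* Let $p$ be a prime number, $q=p^t$ with $t\geq 1$, and $K=\mathbb{F}_q(T)$. Let $F/K$ be an Artin--Schreier extension, namely $F=K(y)$ where $$y^p-y=s(T),$$ with $s(T)\in K$, $s(T)\notin\wp(K)$, and the divisor of $s(T)$ is $$(s(T))_K=\frac{\mathfrak{C}}{\mathcal{P}_1^{\alpha_1}\cdots\mathcal{P}_r^{\alpha_r}},$$ where $r\geq 0$, the $\mathcal{P}_i$ are distinct prime divisors of $K$, $\alpha_i\in\mathbb{N}$, $(\alpha_i,p)=1$, and $\mathfrak{C}$ is an integral divisor relatively prime to $\mathcal{P}_i$ for $i\in\{1,\dots,r\}$. For each $i$ with $\mathcal{P}_i\neq\mathcal{P}_\infty$, let $P_i\in\mathbb{F}_q[T]$ be the monic irreducible polynomial corresponding to $\mathcal{P}_i$. (a) If the prime divisor $\mathcal{P}_\infty$ is not ramified in $F/K$, that is, if $\mathcal{P}_\infty$ is not a factor of $\prod_{i=1}^r\mathcal{P}_i^{\alpha_i}$, then $$F\subseteq K\bigl(\Lambda_{\prod_{i=1}^r P_i^{\alpha_i+1}}\bigr)\,\mathbb{F}_{q^p}.$$ (b) If $\mathcal{P}_\infty$ is ramified in $F/K$, that is, if $\mathcal{P}_\infty$ is a factor of $\prod_{i=1}^r\mathcal{P}_i^{\alpha_i}$, say $\mathcal{P}_\infty=\mathcal{P}_1$, then $$F\subseteq K\bigl(\Lambda_{\frac{1}{T^{\alpha_1+1}}}\bigr)\,K\bigl(\Lambda_{\prod_{i=2}^r P_i^{\alpha_i+1}}\b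igr)\,\mathbb{F}_{q^p}.$$
   Context: All extensions of $K=\mathbb{F}_q(T)$ are taken inside a fixed algebraic closure $\overline{K}$; $\mathbb{N}=\{1,2,\dots\}$; juxtaposition of fields denotes their composite. $\wp(K)=\{b^p-b\mid b\in K\}$. An Artin--Schreier extension of $K$ is a cyclic extension of degree $p=\operatorname{char}K$. Divisors are written multiplicatively; $\mathcal{P}_\infty$ is the prime divisor of $K$ that is the pole of $T$; the other prime divisors of $K$ correspond bijectively to the monic irreducible polynomials of $\mathbb{F}_q[T]$. An empty product of divisors or polynomials is $1$. Carlitz module and cyclotomic function fields: let $R_T=\mathbb{F}_q[T]$. The Carlitz module is the $\mathbb{F}_q$-algebra homomorphism $C$ from $R_T$ to the $\mathbb{F}_q$-linear endomorphisms of $\overline{K}$ determined by $C_T(u)=Tu+u^q$. For $N\in R_T\setminus\{0\}$, $\Lambda_N=\{u\in\overline{K}\mid C_N(u)=0\}$ is the $N$-torsion, and $K(\Lambda_N)$ is the $N$-th cyclotomic function field. The field $K(\Lambda_{1/T^{m}})$ is the cyclotomic function field obtained by replacing the generator $T$ of $K$ by $T'=1/T$: using the Carlitz module for $R_{T'}=\mathbb{F}_q[T']$, given by $C'_{T'}(u)=T'u+u^q$, it is $K(\Lambda'_{T'^{m}})$, where $\Lambda'_{T'^{m}}=\{u\in\overline{K}\mid C'_{T'^{m}}(u)=0\}$. $\mathbb{F}_{q^p}$ is the field with $q^p$ elements. *)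

theory Defs
  imports
    "HOL-Library.Cardinality"
    "HOL-Library.Poly_Mapping"
    "HOL-Computational_Algebra.Computational_Algebra"
    "HOL-Algebra.Algebraic_Closure_Type"
    "HOL-Algebra.Generated_Fields"
begin

text \<open>
  The field of constants \<open>k\<close> is the type \<open>'k\<close>, and \<open>K = k(T)\<close> is the fraction field of \<open>k[T]\<close>.
  Subfields of the fixed algebraic closure are sets; \<open>K\<close> itself is \<open>range to_ac\<close>.
\<close>

type_synonym 'k ratfun = "'k poly fract"
type_synonym 'k ratfun_ac = "'k poly fract alg_closure"

definition T_K :: "'k::field ratfun" where
  "T_K = to_fract [:0, 1:]"

abbreviation K_bar :: "'k::field ratfun_ac ring" where
  "K_bar \<equiv> ring_of_type_algebra"

definition adjoin :: "'k::field ratfun_ac set \<Rightarrow> 'k ratfun_ac set" where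
  "adjoin S = generate_field K_bar (range to_ac \<union> S)"

definition composite :: "'k::field ratfun_ac set \<Rightarrow> 'k ratfun_ac set \<Rightarrow> 'k ratfun_ac set" where
  "composite E F = generate_field K_bar (E \<union> F)"

definition wp :: "nat \<Rightarrow> 'a::field set" where
  "wp p = {b ^ p - b | b. True}"

text \<open>
  A prime divisor of \<open>K\<close> is represented by its valuation, that is, by the normalized discrete
  valuation of \<open>K\<close> that is trivial on the constants. The value at \<open>0\<close>, which should be
  \<open>\<infinity>\<close>, is fixed to be \<open>0\<close> in order that a prime divisor is represented by exactly one
  function.
\<close>

type_synonym 'k valuation = "'k ratfun \<Rightarrow> int"

definition prime_divisors :: "'k::field valuation set" where
  "prime_divisors = {v.
     v 0 = 0 \<and> surj v \<and>
     (\<forall>c. v (to_fract [:c:]) = 0) \<and>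
     (\<forall>x y. x \<noteq> 0 \<longrightarrow> y \<noteq> 0 \<longrightarrow> v (x * y) = v x + v y) \<and>
     (\<forall>x y. x \<noteq> 0 \<longrightarrow> y \<noteq> 0 \<longrightarrow> x + y \<noteq> 0 \<longrightarrow> v (x + y) \<ge> min (v x) (v y))}"

text \<open>
  \<open>P\<close> is the monic irreducible polynomial corresponding to the prime divisor \<open>v\<close>; there is one
  if and only if \<open>v\<close> is not the pole of \<open>T\<close>.
\<close>

definition corresponds :: "'k::field poly \<Rightarrow> 'k valuation \<Rightarrow> bool" where
  "corresponds P v \<longleftrightarrow> Factorial_Ring.irreducible P \<and> lead_coeff P = 1 \<and> v (to_fract P) > 0"

text \<open>
  Divisors are elements of the free abelian group on the prime divisors, here written additively.
\<close>

type_synonym 'k divisor = "'k valuation \<Rightarrow>\<^sub>0 int"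

definition is_divisor :: "'k::field divisor \<Rightarrow> bool" where
  "is_divisor D \<longleftrightarrow> Poly_Mapping.keys D \<subseteq> prime_divisors"

definition integral_divisor :: "'k::field divisor \<Rightarrow> bool" where
  "integral_divisor D \<longleftrightarrow> is_divisor D \<and> (\<forall>v. Poly_Mapping.lookup D v \<ge> 0)"

definition has_divisor :: "'k::field ratfun \<Rightarrow> 'k divisor \<Rightarrow> bool" where
  "has_divisor x D \<longleftrightarrow>
     x \<noteq> 0 \<and> is_divisor D \<and> (\<forall>v\<in>prime_divisors. Poly_Mapping.lookup D v = v x)"

text \<open>
  The Carlitz module with generator \<open>\<tau>\<close>: the \<open>k\<close>-algebra homomorphism from \<open>k[\<tau>]\<close> to the
  \<open>k\<close>-linear endomorphisms of the algebraic closure that sends \<open>\<tau>\<close> to \<open>u \<mapsto> \<tau> u + u ^ q\<close>,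
  \<open>q = |k|\<close>. It is used for \<open>\<tau> = T\<close> and for \<open>\<tau> = 1/T\<close>; the polynomial \<open>N\<close> stands for
  \<open>N(\<tau>)\<close>.
\<close>

definition carlitz ::
    "'k ratfun \<Rightarrow> 'k::{finite,field} poly \<Rightarrow> 'k ratfun_ac \<Rightarrow> 'k ratfun_ac" where
  "carlitz \<tau> N u =
     (\<Sum>i\<le>Polynomial.degree N. to_ac (to_fract [:Polynomial.coeff N i:]) *
        ((\<lambda>w. to_ac \<tau> * w + w ^ CARD('k)) ^^ i) u)"

definition carlitz_torsion :: "'k ratfun \<Rightarrow> 'k::{finite,field} poly \<Rightarrow> 'k ratfun_ac set" where
  "carlitz_torsion \<tau> N = {u. carlitz \<tau> N u = 0}"

definition cyclotomic :: "'k ratfun \<Rightarrow> 'k::{finite,field} poly \<Rightarrow> 'k ratfun_ac set" where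
  "cyclotomic \<tau> N = adjoin (carlitz_torsion \<tau> N)"

end

theory Submission
  imports Defs
begin

text \<open>
  Let \<open>q = |k|\<close>, let \<open>L\<close> be a field containing \<open>\<Lambda>\<^sub>N\<close> for \<open>N = P ^ (e + 1)\<close> with \<open>P\<close>
  irreducible, and let \<open>Fr\<close> raise the coefficients of polynomials over \<open>L\<close> to the power \<open>q\<close>.
  For \<open>u \<in> \<Lambda>\<^sub>N\<close> the generating function \<open>\<Sum>\<^sub>i C\<^bsub>T^i\<^esub>(u) X ^ (- i - 1)\<close> equals \<open>M / N(X)\<close> with a polynomial
  \<open>M\<close> over \<open>L\<close>, and \<open>Fr M \<equiv> (X - T) M\<close> modulo \<open>N(X)\<close>. If \<open>u\<close> generates \<open>\<Lambda>\<^sub>N\<close>, then \<open>M\<close> is a unit modulo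
  \<open>N(X)\<close>: the ideal generated by \<open>M\<close> and \<open>P(X)\<close> is stable under \<open>Fr\<close>, hence defined over \<open>k\<close>.
  The logarithmic derivative \<open>D = M' / M\<close> with respect to \<open>X\<close> then satisfies
  \<open>Fr D - D \<equiv> 1 / (X - T)\<close> modulo \<open>P(X) ^ e\<close>, and applying \<open>k\<close>-linear functionals of
  \<open>k[X] / P(X) ^ e\<close> to this identity solves \<open>w ^ q - w = Q(T) / P(T) ^ e\<close> in \<open>L\<close> for every \<open>Q\<close>
  with \<open>degree Q < degree (P ^ e)\<close>. Partial fractions reduce the theorem to this case; the polynomial
  part of \<open>s\<close> is treated with \<open>1/T\<close> and \<open>P = X\<close>, and its constant term in the field of
  \<open>q ^ p\<close> elements.
\<close>

section \<open>Field embeddings and polynomials over a subfield\<close>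

text \<open>Three kinds of maps are instances: the embedding of \<open>k\<close> into the algebraic
  closure, the power maps \<open>x ^ (p ^ n)\<close>, and the map \<open>x ^ q\<close>, whose
  coefficientwise version is \<open>Fr\<close>.\<close>

locale field_embedding =
  fixes h :: "'a::field \<Rightarrow> 'b::field"
  assumes add: "h (x + y) = h x + h y"
    and mult: "h (x * y) = h x * h y"
    and one [simp]: "h 1 = 1"
begin

lemma zero [simp]: "h 0 = 0"
proof -
  have "h 0 + h 0 = h 0 + 0"
    using add[of 0 0] by (simp only: add_0_right)
  then show ?thesis
    by (simp only: add_left_cancel)
qed

lemma uminus: "h (- x) = - h x"
  using add[of x "- x"] by (simp add: eq_neg_iff_add_eq_0 add.commute)

lemma diff: "h (x - y) = h x - h y"
  using add[of x "- y"] by (simp add: uminus)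

lemma power: "h (x ^ n) = h x ^ n"
  by (induction n) (simp_all add: mult)

lemma sum: "h (sum f A) = (\<Sum>x\<in>A. h (f x))"
  by (induction A rule: infinite_finite_induct) (simp_all add: add)

lemma of_nat: "h (of_nat n) = of_nat n"
  by (induction n) (simp_all add: add)

lemma eq_0_iff [simp]: "h x = 0 \<longleftrightarrow> x = 0"
proof
  assume "h x = 0"
  then have "h (x * inverse x) = 0"
    by (simp add: mult)
  then show "x = 0"
    by (cases "x = 0") auto
qed simp

lemma inj: "inj h"
  by (rule injI) (metis diff eq_0_iff right_minus_eq)

lemma coeff_map [simp]: "coeff (map_poly h f) i = h (coeff f i)"
  by (simp add: coeff_map_poly)

lemma map_add: "map_poly h (f + g) = map_poly h f + map_poly h g"
  by (rule poly_eqI) (simp add: add)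

lemma map_diff: "map_poly h (f - g) = map_poly h f - map_poly h g"
  by (rule poly_eqI) (simp add: diff)

lemma map_mult: "map_poly h (f * g) = map_poly h f * map_poly h g"
  by (rule poly_eqI) (simp add: coeff_mult sum mult)

lemma map_const [simp]: "map_poly h [:c:] = [:h c:]"
  by (cases "c = 0") (simp_all add: map_poly_pCons)

lemma map_power: "map_poly h (f ^ n) = map_poly h f ^ n"
  by (induction n) (simp_all add: map_mult)

lemma map_pderiv: "map_poly h (pderiv f) = pderiv (map_poly h f)"
  by (rule poly_eqI) (simp add: coeff_pderiv mult of_nat add)

lemma map_dvd: "f dvd g \<Longrightarrow> map_poly h f dvd map_poly h g"
  by (auto simp: dvd_def map_mult)

lemma degree_map [simp]: "degree (map_poly h f) = degree f"
  by (rule degree_map_poly) simp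

lemma map_eq_0_iff [simp]: "map_poly h f = 0 \<longleftrightarrow> f = 0"
  by (auto simp: poly_eq_iff)

text \<open>For the nontrivial direction, the image of the remainder \<open>g mod f\<close> is
  divisible by the image of \<open>f\<close> but has smaller degree, so it vanishes.\<close>

lemma map_dvd_iff: "map_poly h f dvd map_poly h g \<longleftrightarrow> f dvd g"
proof
  assume dvd: "map_poly h f dvd map_poly h g"
  show "f dvd g"
  proof (cases "f = 0")
    case False
    have "map_poly h (g mod f) = map_poly h g - map_poly h f * map_poly h (g div f)"
      by (simp add: minus_mult_div_eq_mod flip: map_mult map_diff)
    then have "map_poly h f dvd map_poly h (g mod f)"
      using dvd by simp
    then have "g mod f = 0"
      using False degree_mod_less[of f g] dvd_imp_degree_le[of "map_poly h f" "map_poly h (g mod f)"]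
      by fastforce
    then show ?thesis by blast
  qed (use dvd in simp)
qed (rule map_dvd)

end

text \<open>Intermediate fields are sets, so polynomials over \<open>L\<close> form the subset
  \<open>polys\<close> of all polynomials; quotients, remainders and Bezout coefficients have to
  stay in this subset.\<close>

locale subfield_set =
  fixes L :: "'a::field set"
  assumes one_closed [simp]: "1 \<in> L"
    and add_closed: "x \<in> L \<Longrightarrow> y \<in> L \<Longrightarrow> x + y \<in> L"
    and uminus_closed: "x \<in> L \<Longrightarrow> - x \<in> L"
    and mult_closed: "x \<in> L \<Longrightarrow> y \<in> L \<Longrightarrow> x * y \<in> L"
    and inverse_closed: "x \<in> L \<Longrightarrow> inverse x \<in> L"
begin

lemma diff_closed: "x \<in> L \<Longrightarrow> y \<in> L \<Longrightarrow> x - y \<in> L"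
  using add_closed[of x "- y"] by (simp add: uminus_closed)

lemma zero_closed [simp]: "0 \<in> L"
  using diff_closed[of 1 1] by simp

lemma power_closed: "x \<in> L \<Longrightarrow> x ^ n \<in> L"
  by (induction n) (auto intro: mult_closed)

lemma sum_closed: "(\<And>x. x \<in> A \<Longrightarrow> f x \<in> L) \<Longrightarrow> sum f A \<in> L"
  by (induction A rule: infinite_finite_induct) (auto intro: add_closed)

lemma of_nat_closed: "of_nat n \<in> L"
  by (induction n) (auto intro: add_closed)

definition polys :: "'a poly set" where
  "polys = {f. \<forall>i. coeff f i \<in> L}"

lemma coeff_closed: "f \<in> polys \<Longrightarrow> coeff f i \<in> L"
  by (simp add: polys_def)

lemma polysI: "(\<And>i. coeff f i \<in> L) \<Longrightarrow> f \<in> polys"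
  by (simp add: polys_def)

lemma polys_add: "f \<in> polys \<Longrightarrow> g \<in> polys \<Longrightarrow> f + g \<in> polys"
  by (simp add: polys_def add_closed)

lemma polys_diff: "f \<in> polys \<Longrightarrow> g \<in> polys \<Longrightarrow> f - g \<in> polys"
  by (simp add: polys_def diff_closed)

lemma polys_mult: "f \<in> polys \<Longrightarrow> g \<in> polys \<Longrightarrow> f * g \<in> polys"
  by (auto simp: polys_def coeff_mult intro!: sum_closed mult_closed)

lemma polys_monom: "c \<in> L \<Longrightarrow> monom c n \<in> polys"
  by (simp add: polys_def)

lemma polys_smult: "c \<in> L \<Longrightarrow> f \<in> polys \<Longrightarrow> smult c f \<in> polys"
  by (simp add: polys_def mult_closed)

lemma polys_0 [simp]: "0 \<in> polys"
  by (simp add: polys_def)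

lemma polys_1 [simp]: "1 \<in> polys"
  by (simp add: polys_def coeff_1)

lemma polys_power: "f \<in> polys \<Longrightarrow> f ^ n \<in> polys"
  by (induction n) (auto intro: polys_mult)

lemma polys_sum: "(\<And>x. x \<in> A \<Longrightarrow> f x \<in> polys) \<Longrightarrow> sum f A \<in> polys"
  by (induction A rule: infinite_finite_induct) (auto intro: polys_add)

lemma polys_pderiv: "f \<in> polys \<Longrightarrow> pderiv f \<in> polys"
  by (auto simp: polys_def coeff_pderiv simp del: of_nat_Suc intro!: mult_closed of_nat_closed)

text \<open>Long division does not leave \<open>L\<close>: each step subtracts a monomial multiple
  of \<open>g\<close> whose coefficient is a quotient of two leading coefficients.\<close>

lemma polys_division:
  assumes "f \<in> polys" "g \<in> polys" "g \<noteq> 0"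
  shows "\<exists>a\<in>polys. \<exists>r\<in>polys. f = g * a + r \<and> (r = 0 \<or> degree r < degree g)"
  using assms(1)
proof (induction "degree f" arbitrary: f rule: less_induct)
  case less
  show ?case
  proof (cases "f = 0 \<or> degree f < degree g")
    case True
    with less.prems show ?thesis
      by (intro bexI[of _ 0] bexI[of _ f]) auto
  next
    case False
    define m where "m = monom (lead_coeff f / lead_coeff g) (degree f - degree g)"
    have "lead_coeff f / lead_coeff g \<in> L"
      using less.prems assms(2)
      by (auto simp: divide_inverse intro!: mult_closed inverse_closed coeff_closed)
    then have m: "m \<in> polys"
      by (simp add: m_def polys_monom)
    define f' where "f' = f - g * m"
    have f': "f' \<in> polys"
      using less.prems assms(2) m by (simp add: f'_def polys_diff polys_mult)
    have deg: "degree (g * m) = degree f"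
      using False assms(3) by (simp add: m_def degree_mult_eq degree_monom_eq)
    have "lead_coeff (g * m) = lead_coeff f"
      using False assms(3) by (simp add: lead_coeff_mult m_def degree_monom_eq)
    then have lc: "coeff f' (degree f) = 0"
      using deg by (simp add: f'_def)
    have "degree f' \<le> degree f"
      unfolding f'_def by (rule degree_diff_le) (simp_all add: deg)
    show ?thesis
    proof (cases "f' = 0")
      case True
      then show ?thesis
        using m by (intro bexI[of _ m] bexI[of _ 0]) (auto simp: f'_def)
    next
      case f'0: False
      have "degree f' \<noteq> degree f"
        using lc f'0 by (metis leading_coeff_0_iff)
      with \<open>degree f' \<le> degree f\<close> have "degree f' < degree f" by simp
      from less.hyps[OF this f'] obtain a r where ar: "a \<in> polys" "r \<in> polys"
        "f' = g * a + r" "r = 0 \<or> degree r < degree g" by blast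
      have "f = g * (m + a) + r"
        using ar(3) by (simp add: f'_def algebra_simps)
      with ar m show ?thesis
        by (intro bexI[of _ "m + a"] bexI[of _ r]) (auto intro: polys_add)
    qed
  qed
qed

text \<open>A nonzero element of least degree in the ideal generated by \<open>a\<close> and
  \<open>b\<close> over \<open>L\<close>, made monic, divides every element of the ideal, since
  remainders lie in the ideal too.\<close>

lemma polys_bezout:
  assumes "a \<in> polys" "b \<in> polys" "b \<noteq> 0"
  shows "\<exists>u\<in>polys. \<exists>v\<in>polys. lead_coeff (u * a + v * b) = 1 \<and>
           u * a + v * b dvd a \<and> u * a + v * b dvd b"
proof -
  define I where "I = {u * a + v * b | u v. u \<in> polys \<and> v \<in> polys}"
  have I_sub: "x - y \<in> I" if "x \<in> I" "y \<in> I" for x y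
  proof -
    from that obtain u v u' v' where
      "x = u * a + v * b" "y = u' * a + v' * b" "u \<in> polys" "v \<in> polys" "u' \<in> polys" "v' \<in> polys"
      by (auto simp: I_def)
    then have "x - y = (u - u') * a + (v - v') * b" "u - u' \<in> polys" "v - v' \<in> polys"
      by (auto simp: algebra_simps polys_diff)
    then show ?thesis by (auto simp: I_def)
  qed
  have I_mult: "x * c \<in> I" if "x \<in> I" "c \<in> polys" for x c
  proof -
    from that obtain u v where "x = u * a + v * b" "u \<in> polys" "v \<in> polys"
      by (auto simp: I_def)
    then have "x * c = (u * c) * a + (v * c) * b" "u * c \<in> polys" "v * c \<in> polys"
      using that by (auto simp: algebra_simps polys_mult)
    then show ?thesis unfolding I_def by blast
  qed
  have aI: "a \<in> I" unfolding I_def by (rule CollectI, rule exI[of _ 1], rule exI[of _ 0]) simp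
  have bI: "b \<in> I" unfolding I_def by (rule CollectI, rule exI[of _ 0], rule exI[of _ 1]) simp
  have I_polys: "x \<in> polys" if "x \<in> I" for x
    using that assms by (auto simp: I_def intro!: polys_add polys_mult)
  have "\<exists>x. x \<in> I \<and> x \<noteq> 0" using bI assms by blast
  then obtain g0 where g0: "g0 \<in> I" "g0 \<noteq> 0" and min: "\<And>x. x \<in> I \<Longrightarrow> x \<noteq> 0 \<Longrightarrow> degree g0 \<le> degree x"
    using ex_has_least_nat[of "\<lambda>x. x \<in> I \<and> x \<noteq> 0" _ degree] by blast
  define g where "g = g0 * [:inverse (lead_coeff g0):]"
  have gI: "g \<in> I"
    unfolding g_def using g0
    by (intro I_mult polysI) (auto simp: coeff_pCons split: nat.split intro!: inverse_closed coeff_closed I_polys)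
  have lg: "lead_coeff g = 1" and dg: "degree g = degree g0"
    using g0 by (simp_all add: g_def)
  have dvd: "g dvd x" if xI: "x \<in> I" for x
  proof -
    obtain c r where cr: "c \<in> polys" "r \<in> polys" "x = g * c + r" "r = 0 \<or> degree r < degree g"
      using polys_division[OF I_polys[OF xI] I_polys[OF gI]] lg by fastforce
    have "r = x - g * c" using cr by simp
    then have "r \<in> I" using I_sub[OF xI I_mult[OF gI cr(1)]] by simp
    then have "r = 0" using min[of r] cr(4) dg by (cases "r = 0") auto
    then show ?thesis using cr by simp
  qed
  from gI obtain u v where "g = u * a + v * b" "u \<in> polys" "v \<in> polys"
    by (auto simp: I_def)
  then show ?thesis using dvd[OF aI] dvd[OF bI] lg by blast
qed

end

section \<open>Finite multiplicatively closed sets and the roots of \<open>x ^ n = x\<close>\<close>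

lemma power_card_eq_1:
  fixes S :: "'a::field set"
  assumes "finite S" "0 \<notin> S" "\<And>x y. x \<in> S \<Longrightarrow> y \<in> S \<Longrightarrow> x * y \<in> S" "x \<in> S"
  shows "x ^ card S = 1"
proof -
  have inj: "inj_on ((*) x) S"
    using assms by (auto simp: inj_on_def)
  have "(*) x ` S = S"
    using assms inj by (intro endo_inj_surj) auto
  \<comment> \<open>Multiplication by \<open>x\<close> permutes \<open>S\<close>, which leaves the
    product of all elements unchanged.\<close>
  then have "\<Prod>S = (\<Prod>y\<in>S. x * y)"
    using prod.reindex[OF inj, of "\<lambda>y. y"] by simp
  also have "\<dots> = x ^ card S * \<Prod>S"
    by (simp add: prod.distrib)
  finally show ?thesis
    using assms by (simp add: prod_zero_iff)
qed

lemma power_card_eq_self: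
  fixes S :: "'a::field set"
  assumes "finite S" "0 \<in> S" "\<And>x y. x \<in> S \<Longrightarrow> y \<in> S \<Longrightarrow> x * y \<in> S" "x \<in> S"
  shows "x ^ card S = x"
proof (cases "x = 0")
  case True
  then show ?thesis
    using assms(1,2) by (auto simp: power_0_left card_eq_0_iff)
next
  case False
  have "x ^ card (S - {0}) = 1"
    using assms False by (intro power_card_eq_1) auto
  moreover have "card S = Suc (card (S - {0}))"
    using assms(1,2) by (rule card.remove)
  ultimately show ?thesis by simp
qed

lemma card_power_eq_self_le:
  assumes "n \<ge> 2"
  shows "finite {x::'a::field. x ^ n = x}" "card {x::'a::field. x ^ n = x} \<le> n"
proof -
  define f :: "'a poly" where "f = monom 1 n - monom 1 1"
  have deg: "degree f = n"
    unfolding f_def using assms degree_add_eq_left[of "- monom 1 1" "monom (1::'a) n"]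
    by (simp add: degree_monom_eq)
  then have f0: "f \<noteq> 0"
    using assms by auto
  have eq: "{x::'a. x ^ n = x} = {x. poly f x = 0}"
    by (auto simp: f_def poly_monom)
  show "finite {x::'a. x ^ n = x}"
    unfolding eq by (rule poly_roots_finite[OF f0])
  show "card {x::'a. x ^ n = x} \<le> n"
    unfolding eq using card_poly_roots_bound[OF f0] deg by simp
qed

text \<open>All \<open>n\<close> elements of \<open>S\<close> are roots of \<open>X ^ n - X\<close>,
  which has at most \<open>n\<close> roots. This identifies the image of \<open>k\<close> (with
  \<open>n = q\<close>) and the field of \<open>q ^ p\<close> elements.\<close>

lemma powers_eq_self_set:
  fixes S :: "'a::field set"
  assumes "card S = n" "n \<ge> 2" "0 \<in> S" "\<And>x y. x \<in> S \<Longrightarrow> y \<in> S \<Longrightarrow> x * y \<in> S"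
  shows "S = {x. x ^ n = x}"
proof -
  have fin: "finite S"
    using assms(1,2) by (intro card_ge_0_finite) simp
  have "S \<subseteq> {x. x ^ n = x}"
    using power_card_eq_self[OF fin assms(3,4)] assms(1) by auto
  then show ?thesis
    using card_power_eq_self_le[OF assms(2), where 'a = 'a] assms(1)
    by (intro card_seteq) simp_all
qed

section \<open>The Carlitz module\<close>

text \<open>In the application \<open>\<tau>\<close> is \<open>T\<close> or \<open>1/T\<close>. Its
  transcendence over \<open>k\<close> makes the linear coefficient of the Carlitz polynomial of
  \<open>N \<noteq> 0\<close> nonzero and keeps denominators from vanishing at
  \<open>\<tau>\<close>.\<close>

locale carlitz_module = field_embedding \<iota>
  for \<iota> :: "'k::{finite,field} \<Rightarrow> 'a::alg_closed_field" +
  fixes p t q :: nat and \<tau> :: 'a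
  assumes prime_p: "Factorial_Ring.prime p"
    and card_k: "CARD('k) = q"
    and q_def: "q = p ^ t"
    and transcendental: "f \<noteq> 0 \<Longrightarrow> poly (map_poly \<iota> f) \<tau> \<noteq> 0"
begin

lemma q_ge_2: "q \<ge> 2"
proof -
  have "card {0, 1::'k} \<le> CARD('k)"
    by (rule card_mono) auto
  then show ?thesis by (simp add: card_k)
qed

text \<open>The sum of all elements of \<open>k\<close> is invariant under translation by 1, so
  \<open>q = 0\<close> in \<open>k\<close>, and \<open>q\<close> is a power of
  \<open>p\<close>.\<close>

lemma of_nat_p_k: "of_nat p = (0::'k)"
proof -
  have "(\<Sum>x\<in>UNIV. x + 1) = (\<Sum>x\<in>UNIV. x::'k)"
    by (rule sum.reindex_bij_witness[of _ "\<lambda>x. x - 1" "\<lambda>x. x + 1"]) auto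
  then have "of_nat q = (0::'k)"
    by (simp add: sum.distrib card_k)
  then show ?thesis
    by (simp add: q_def)
qed

lemma CHAR_eq: "CHAR('a) = p"
proof -
  have "of_nat p = (0::'a)"
    using of_nat[of p] by (simp add: of_nat_p_k)
  then have "CHAR('a) dvd p"
    by (simp add: of_nat_eq_0_iff_char_dvd)
  then have "CHAR('a) = 1 \<or> CHAR('a) = p"
    using prime_p unfolding prime_nat_iff by blast
  then show ?thesis
    using of_nat_CHAR[where 'a = 'a] by auto
qed

lemma frobenius_embedding: "field_embedding (\<lambda>x::'a. x ^ (p ^ n))"
  by standard (simp_all add: freshmans_dream'[of _ n] CHAR_eq prime_p power_mult_distrib)

sublocale fr: field_embedding "\<lambda>x::'a. x ^ q"
  unfolding q_def by (rule frobenius_embedding)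

lemma const_power: "\<iota> c ^ q = \<iota> c"
  using power_card_eq_self[of UNIV c] by (simp add: card_k flip: power)

lemma range_const: "range \<iota> = {x. x ^ q = x}"
  by (rule powers_eq_self_set) (auto simp: card_image inj q_ge_2 card_k simp flip: mult intro: range_eqI[of _ _ 0])

definition \<phi> :: "'a \<Rightarrow> 'a" where
  "\<phi> w = \<tau> * w + w ^ q"

definition act :: "'k poly \<Rightarrow> 'a \<Rightarrow> 'a" where
  "act N u = (\<Sum>i\<le>degree N. \<iota> (coeff N i) * (\<phi> ^^ i) u)"

lemma phi_add: "\<phi> (u + v) = \<phi> u + \<phi> v"
  by (simp add: \<phi>_def fr.add algebra_simps)

lemma phi_const_mult: "\<phi> (\<iota> c * u) = \<iota> c * \<phi> u"
  by (simp add: \<phi>_def power_mult_distrib const_power algebra_simps)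

lemma phi_0 [simp]: "\<phi> 0 = 0"
  by (simp add: \<phi>_def)

lemma phi_sum: "\<phi> (sum f A) = (\<Sum>x\<in>A. \<phi> (f x))"
  by (induction A rule: infinite_finite_induct) (simp_all add: phi_add)

lemma act_altdef: "degree N \<le> n \<Longrightarrow> act N u = (\<Sum>i\<le>n. \<iota> (coeff N i) * (\<phi> ^^ i) u)"
  unfolding act_def by (rule sum.mono_neutral_left) (auto simp: coeff_eq_0)

lemma act_0 [simp]: "act 0 u = 0"
  by (simp add: act_def)

lemma act_add_left: "act (f + g) u = act f u + act g u"
proof -
  define n where "n = max (degree f) (degree g)"
  have "degree (f + g) \<le> n"
    by (simp add: n_def degree_add_le_max)
  then show ?thesis
    by (simp add: act_altdef[of _ n] n_def add algebra_simps sum.distrib)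
qed

lemma act_smult: "act (smult c f) u = \<iota> c * act f u"
  by (simp add: act_altdef[of "smult c f" "degree f"] act_def mult sum_distrib_left mult.assoc)

lemma act_const: "act [:c:] u = \<iota> c * u"
  by (simp add: act_def)

lemma act_shift: "act (pCons 0 f) u = \<phi> (act f u)"
proof -
  have "act (pCons 0 f) u = (\<Sum>i\<le>Suc (degree f). \<iota> (coeff (pCons 0 f) i) * (\<phi> ^^ i) u)"
    by (rule act_altdef) (rule degree_pCons_le)
  also have "\<dots> = (\<Sum>i\<le>degree f. \<iota> (coeff f i) * (\<phi> ^^ Suc i) u)"
    by (subst sum.atMost_Suc_shift) simp
  also have "\<dots> = \<phi> (act f u)"
    by (simp add: act_def phi_sum phi_const_mult)
  finally show ?thesis .
qed

lemma act_0_right [simp]: "act f 0 = 0"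
proof -
  have "(\<phi> ^^ i) 0 = 0" for i
    by (induction i) simp_all
  then show ?thesis
    by (simp add: act_def)
qed

lemma act_mult: "act (f * g) u = act f (act g u)"
proof (induction f)
  case (pCons a f)
  have "act (pCons a f * g) u = \<iota> a * act g u + \<phi> (act f (act g u))"
    by (simp add: act_add_left act_smult act_shift pCons.IH)
  also have "\<dots> = act ([:a:] + pCons 0 f) (act g u)"
    by (simp only: act_add_left act_shift act_const)
  finally show ?case by simp
qed simp

lemma act_dvd: "f dvd g \<Longrightarrow> act f u = 0 \<Longrightarrow> act g u = 0"
  by (auto simp: dvd_def act_mult mult.commute)

section \<open>Carlitz polynomials and torsion points\<close>

fun iter_poly :: "nat \<Rightarrow> 'a poly" where
  "iter_poly 0 = [:0, 1:]"
| "iter_poly (Suc i) = smult \<tau> (iter_poly i) + iter_poly i ^ q"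

lemma iter_poly:
  "poly (iter_poly i) u = (\<phi> ^^ i) u"
  "degree (iter_poly i) = q ^ i"
  "coeff (iter_poly i) 0 = 0"
  "coeff (iter_poly i) 1 = \<tau> ^ i"
  "lead_coeff (iter_poly i) = 1"
proof (induction i)
  case (Suc i)
  have "iter_poly i \<noteq> 0"
    using Suc.IH(5) by auto
  then have deg: "degree (iter_poly i ^ q) = q ^ Suc i"
    by (simp add: degree_power_eq Suc.IH)
  have "degree (smult \<tau> (iter_poly i)) \<le> q ^ i"
    using degree_smult_le[of \<tau> "iter_poly i"] Suc.IH by simp
  also have "\<dots> < q ^ Suc i"
    using q_ge_2 by simp
  finally have less: "degree (smult \<tau> (iter_poly i)) < degree (iter_poly i ^ q)"
    by (simp add: deg)
  obtain h where h: "iter_poly i = pCons 0 h"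
    using Suc.IH(3) by (metis coeff_pCons_0 pCons_cases)
  obtain n where n: "q = Suc (Suc n)"
    using q_ge_2 by (metis add_2_eq_Suc le_Suc_ex)
  \<comment> \<open>Since \<open>q \<ge> 2\<close>, the \<open>q\<close>-th power of a multiple of
    \<open>X\<close> has no linear term; only the summand with factor \<open>\<tau>\<close>
    contributes to it.\<close>
  have "coeff (pCons 0 h ^ Suc (Suc n)) 1 = 0"
    by simp
  then have c1: "coeff (iter_poly i ^ q) 1 = 0"
    unfolding h by (simp only: n)
  {
    case 1
    show ?case by (simp add: Suc.IH \<phi>_def)
  next
    case 2
    show ?case using less by (simp add: degree_add_eq_right deg)
  next
    case 3
    show ?case using q_ge_2 by (simp add: Suc.IH coeff_0_power)
  next
    case 4
    show ?case using c1 Suc.IH(4) by simp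
  next
    case 5
    show ?case
      using lead_coeff_add_le[OF less] Suc.IH(5) lead_coeff_power[of "iter_poly i" q]
      by (simp only: iter_poly.simps power_one)
  }
qed simp_all

text \<open>\<open>E\<close> is the Carlitz polynomial of \<open>N\<close>. Its linear coefficient
  \<open>N(\<tau>)\<close> is nonzero by transcendence, so 0 is a simple root.\<close>

lemma act_eq_poly:
  assumes "N \<noteq> 0"
  obtains E where "\<And>u. poly E u = act N u" "degree E = q ^ degree N" "coeff E 0 = 0"
    "coeff E 1 = poly (map_poly \<iota> N) \<tau>"
proof
  define E where "E = (\<Sum>i\<le>degree N. smult (\<iota> (coeff N i)) (iter_poly i))"
  show "poly E u = act N u" for u
    by (simp add: E_def poly_sum act_def iter_poly)
  show "coeff E 0 = 0"
    by (simp add: E_def coeff_sum iter_poly)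
  show "coeff E 1 = poly (map_poly \<iota> N) \<tau>"
    by (simp add: E_def coeff_sum iter_poly poly_altdef flip: One_nat_def)
  have "coeff E (q ^ degree N) = \<iota> (lead_coeff N)"
  proof -
    have "coeff (iter_poly i) (q ^ degree N) = 0" if "i < degree N" for i
      by (rule coeff_eq_0) (use that q_ge_2 in \<open>simp add: iter_poly power_strict_increasing\<close>)
    moreover have "coeff (iter_poly (degree N)) (q ^ degree N) = 1"
      using iter_poly(2,5)[of "degree N"] by simp
    ultimately show ?thesis
      unfolding E_def by (simp add: coeff_sum lessThan_Suc_atMost[symmetric])
  qed
  then have "degree E \<ge> q ^ degree N"
    using assms by (intro le_degree) simp
  moreover have "degree E \<le> q ^ degree N"
    unfolding E_def
    by (rule degree_sum_le)
      (use q_ge_2 in \<open>auto simp: iter_poly intro!: order_trans[OF degree_smult_le] power_increasing\<close>)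
  ultimately show "degree E = q ^ degree N" by simp
qed

lemma act_surj:
  assumes "N \<noteq> 0"
  obtains u where "act N u = c"
proof -
  obtain E where E: "\<And>u. poly E u = act N u" "degree E = q ^ degree N"
    using act_eq_poly[OF assms] by metis
  have "degree (E - [:c:]) = degree E"
    unfolding diff_conv_add_uminus
    by (rule degree_add_eq_left) (use E(2) q_ge_2 in simp)
  then have "degree (E - [:c:]) > 0"
    using E(2) q_ge_2 by simp
  then obtain u where "poly (E - [:c:]) u = 0"
    using alg_closed_imp_poly_has_root by blast
  then show ?thesis
    using that E(1) by simp
qed

text \<open>The Carlitz polynomial of \<open>P\<close> divided by \<open>X\<close> has positive
  degree and constant term \<open>P(\<tau>) \<noteq> 0\<close>, hence a root
  \<open>x \<noteq> 0\<close>. Any preimage \<open>w\<close> of \<open>x\<close> under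
  \<open>act N\<close> serves.\<close>

lemma exists_torsion_point:
  assumes "degree P > 0"
  obtains w where "act (P * N) w = 0" "N \<noteq> 0 \<Longrightarrow> act N w \<noteq> 0"
proof -
  have P0: "P \<noteq> 0"
    using assms by auto
  obtain E where E: "\<And>u. poly E u = act P u" "degree E = q ^ degree P" "coeff E 0 = 0"
    "coeff E 1 = poly (map_poly \<iota> P) \<tau>"
    using act_eq_poly[OF P0] by metis
  obtain H where H: "E = pCons 0 H"
    using E(3) by (metis coeff_pCons_0 pCons_cases)
  have "q ^ 1 \<le> q ^ degree P"
    using assms q_ge_2 by (intro power_increasing) auto
  then have "degree E \<ge> 2"
    using E(2) q_ge_2 by simp
  then have "degree H > 0"
    by (simp add: H split: if_splits)
  then obtain x where x: "poly H x = 0"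
    using alg_closed_imp_poly_has_root by blast
  have "coeff H 0 \<noteq> 0"
    using E(4) transcendental[OF P0] by (simp add: H)
  then have "x \<noteq> 0"
    using x by (auto simp: poly_0_coeff_0)
  have Px: "act P x = 0"
    using x by (simp add: H flip: E(1))
  show ?thesis
  proof (cases "N = 0")
    case True
    then show ?thesis using that[of 0] by simp
  next
    case False
    then obtain w where "act N w = x"
      using act_surj by blast
    then show ?thesis
      using that[of w] Px \<open>x \<noteq> 0\<close> by (simp add: act_mult)
  qed
qed

end

section \<open>Generating functions of torsion points and their Frobenius recursion\<close>

context carlitz_module
begin

abbreviation emb :: "'k poly \<Rightarrow> 'a poly" where "emb \<equiv> map_poly \<iota>"
abbreviation Fr :: "'a poly \<Rightarrow> 'a poly" where "Fr \<equiv> map_poly (\<lambda>x. x ^ q)"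

lemma Fr_emb [simp]: "Fr (emb f) = emb f"
  by (rule poly_eqI) (simp add: const_power)

lemma Fr_fixed:
  assumes "Fr g = g"
  obtains g0 where "g = emb g0"
proof
  have "coeff g i \<in> range \<iota>" for i
    using arg_cong[OF assms, of "\<lambda>f. coeff f i"] by (simp add: range_const)
  then have "\<iota> (inv_into UNIV \<iota> (coeff g i)) = coeff g i" for i
    by (rule f_inv_into_f)
  moreover have "inv_into UNIV \<iota> 0 = 0"
    using inv_f_f[OF inj, of 0] by simp
  ultimately show "g = emb (map_poly (inv_into UNIV \<iota>) g)"
    by (intro poly_eqI) (simp add: coeff_map_poly)
qed

text \<open>The polynomial part of \<open>N(X)\<close> times the series of all
  \<open>(\<phi> ^^ i) u * X ^ (- i - 1)\<close>: shifting \<open>N(X)\<close> by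
  \<open>Suc i\<close> takes the polynomial part of \<open>N(X) * X ^ (- i - 1)\<close>. For
  \<open>u\<close> in the \<open>N\<close>-torsion nothing is cut off.\<close>

definition gen_poly :: "'k poly \<Rightarrow> 'a \<Rightarrow> 'a poly" where
  "gen_poly N u = (\<Sum>i<degree N. smult ((\<phi> ^^ i) u) (poly_shift (Suc i) (emb N)))"

lemma poly_shift_Suc:
  fixes f :: "'a poly"
  shows "[:0, 1:] * poly_shift (Suc i) f = poly_shift i f - [:coeff f i:]"
  by (rule poly_eqI) (simp add: coeff_poly_shift coeff_pCons split: nat.split)

text \<open>With \<open>c i = (\<phi> ^^ i) u\<close>, the definition of \<open>\<phi>\<close> gives
  \<open>c i ^ q = c (Suc i) - \<tau> * c i\<close>, so each summand contributes a telescoping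
  difference and a constant. The constants and the upper boundary term add up to
  \<open>act N u\<close>, the defect that vanishes on torsion.\<close>

lemma Fr_gen_poly:
  "Fr (gen_poly N u) = [:- \<tau>, 1:] * gen_poly N u - smult u (emb N) + [:act N u:]"
proof -
  define S where "S i = poly_shift i (emb N)" for i
  define c where "c i = (\<phi> ^^ i) u" for i
  have FrS: "Fr (S i) = S i" for i
    by (rule poly_eqI) (simp add: S_def coeff_poly_shift const_power)
  have XS: "[:0, 1:] * S (Suc i) = S i - [:\<iota> (coeff N i):]" for i
    unfolding S_def by (subst poly_shift_Suc) simp
  have S0: "S 0 = emb N" and Sn: "S (degree N) = [:\<iota> (lead_coeff N):]"
    by (rule poly_eqI; simp add: S_def coeff_poly_shift coeff_pCons coeff_eq_0 split: nat.split)+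
  have "Fr (smult (c i) (S (Suc i))) - [:- \<tau>, 1:] * smult (c i) (S (Suc i))
      = (smult (c (Suc i)) (S (Suc i)) - smult (c i) (S i)) + [:c i * \<iota> (coeff N i):]" for i
  proof -
    have "Fr (smult (c i) (S (Suc i))) = smult (c i ^ q) (S (Suc i))"
      using fr.map_mult[of "[:c i:]" "S (Suc i)"] by (simp add: FrS)
    moreover have "[:- \<tau>, 1:] * smult (c i) (S (Suc i))
        = smult (c i) ([:0, 1:] * S (Suc i)) - smult (\<tau> * c i) (S (Suc i))"
      by (simp add: smult_diff_right smult_minus_left algebra_simps)
    moreover have "c i ^ q + \<tau> * c i = c (Suc i)"
      by (simp add: c_def \<phi>_def)
    ultimately show ?thesis
      by (simp only: XS) (simp add: smult_diff_right algebra_simps flip: smult_add_left)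
  qed
  then have "(\<Sum>i<degree N. Fr (smult (c i) (S (Suc i))) - [:- \<tau>, 1:] * smult (c i) (S (Suc i)))
      = (\<Sum>i<degree N. smult (c (Suc i)) (S (Suc i)) - smult (c i) (S i)) + (\<Sum>i<degree N. [:c i * \<iota> (coeff N i):])"
    by (simp add: sum.distrib)
  also have "(\<Sum>i<degree N. smult (c (Suc i)) (S (Suc i)) - smult (c i) (S i))
      = smult (c (degree N)) (S (degree N)) - smult u (emb N)"
    by (subst sum_lessThan_telescope) (simp add: S0 c_def)
  also have "(\<Sum>i<degree N. [:c i * \<iota> (coeff N i):]) = [:\<Sum>i<degree N. c i * \<iota> (coeff N i):]"
    by (rule poly_eqI) (simp add: coeff_sum coeff_pCons split: nat.split)
  also have "smult (c (degree N)) (S (degree N)) - smult u (emb N) + [:\<Sum>i<degree N. c i * \<iota> (coeff N i):]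
      = [:act N u:] - smult u (emb N)"
    by (simp add: Sn act_def c_def algebra_simps flip: lessThan_Suc_atMost)
  finally have "(\<Sum>i<degree N. Fr (smult (c i) (S (Suc i))) - [:- \<tau>, 1:] * smult (c i) (S (Suc i)))
     = [:act N u:] - smult u (emb N)" .
  moreover have "Fr (gen_poly N u) = (\<Sum>i<degree N. Fr (smult (c i) (S (Suc i))))"
  proof -
    have "Fr (sum f A) = (\<Sum>x\<in>A. Fr (f x))" for f and A :: "nat set"
      by (induction A rule: infinite_finite_induct) (simp_all add: fr.map_add)
    then show ?thesis by (simp add: gen_poly_def S_def c_def)
  qed
  moreover have "gen_poly N u = (\<Sum>i<degree N. smult (c i) (S (Suc i)))"
    by (simp add: gen_poly_def S_def c_def)
  ultimately show ?thesis
    by (simp add: sum_subtractf sum_distrib_left algebra_simps)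
qed

text \<open>
  The recursion for \<open>Fr M\<close> determines \<open>M\<close>, since a difference \<open>E\<close> of two solutions would
  satisfy \<open>degree ((X - \<tau>) * E) > degree (Fr E)\<close>.
\<close>

lemma act_eq_0_if_Fr_eq:
  assumes "Fr M = [:- \<tau>, 1:] * M - smult u (emb N)"
  shows "act N u = 0"
proof -
  define E where "E = gen_poly N u - M"
  have E: "Fr E = [:- \<tau>, 1:] * E + [:act N u:]"
    by (simp only: E_def fr.map_diff assms Fr_gen_poly) (simp add: algebra_simps)
  have "E = 0"
  proof (rule ccontr)
    assume "E \<noteq> 0"
    then have "degree ([:- \<tau>, 1:] * E) = Suc (degree E)"
      by (simp add: degree_mult_eq del: mult_pCons_left)
    then have "degree (Fr E) = Suc (degree E)"
      by (simp only: E) (subst degree_add_eq_left; simp)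
    then show False by simp
  qed
  then show ?thesis using E by simp
qed

text \<open>Since \<open>Fr\<close> fixes \<open>emb P\<close>, this factor can be cancelled from
  the recursion for \<open>P * N\<close>. What remains is the recursion for \<open>N\<close> with
  the same \<open>u\<close>.\<close>

lemma act_eq_0_if_dvd_gen_poly:
  assumes "P \<noteq> 0" "act (P * N) u = 0" "emb P dvd gen_poly (P * N) u"
  shows "act N u = 0"
proof -
  obtain M where M: "gen_poly (P * N) u = emb P * M"
    using assms(3) by blast
  have "Fr (emb P * M) = [:- \<tau>, 1:] * (emb P * M) - smult u (emb (P * N))"
    using Fr_gen_poly[of "P * N" u] by (simp only: M assms(2) pCons_0_0 add_0_right)
  then have "emb P * Fr M = emb P * ([:- \<tau>, 1:] * M - smult u (emb N))"
    by (simp add: fr.map_mult map_mult algebra_simps)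
  then have "Fr M = [:- \<tau>, 1:] * M - smult u (emb N)"
    using assms(1) by simp
  then show ?thesis
    by (rule act_eq_0_if_Fr_eq)
qed

text \<open>As \<open>\<tau>\<close> is not a root of \<open>Fr g\<close>, the factor
  \<open>X - \<tau>\<close> cancels and \<open>Fr g\<close> divides \<open>g\<close>. Both are monic
  of the same degree. In this way a \<open>Fr\<close>-stable ideal is seen to be generated over
  \<open>k\<close>.\<close>

lemma Fr_eq_self_if_dvd:
  assumes "lead_coeff g = 1" "Fr g dvd [:- \<tau>, 1:] * g" "poly (Fr g) \<tau> \<noteq> 0"
  shows "Fr g = g"
proof -
  obtain h where h: "[:- \<tau>, 1:] * g = Fr g * h"
    using assms(2) by blast
  have "poly (Fr g * h) \<tau> = 0"
    by (simp flip: h)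
  then have "[:- \<tau>, 1:] dvd h"
    using assms(3) by (simp add: poly_eq_0_iff_dvd)
  then obtain h' where h': "h = [:- \<tau>, 1:] * h'" by blast
  have "[:- \<tau>, 1:] * g = [:- \<tau>, 1:] * (Fr g * h')"
    using h h' by (simp only: mult.left_commute)
  then have eq: "g = Fr g * h'"
    by (simp only: mult_cancel_left) simp
  have "g \<noteq> 0" "Fr g \<noteq> 0" "h' \<noteq> 0"
    using assms(1) eq by auto
  then have "degree g = degree (Fr g) + degree h'"
    using eq by (metis degree_mult_eq)
  then have "degree h' = 0" by simp
  moreover have "lead_coeff g = lead_coeff (Fr g) * lead_coeff h'"
    using eq by (metis lead_coeff_mult)
  ultimately have "h' = 1"
    using assms(1) q_ge_2 by (auto elim!: degree_eq_zeroE simp: one_pCons)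
  then show ?thesis using eq by simp
qed

end

locale carlitz_subfield = carlitz_module \<iota> p t q \<tau> + subfield_set L
  for \<iota> :: "'k::{finite,field} \<Rightarrow> 'a::alg_closed_field" and p t q \<tau> and L :: "'a set" +
  assumes const_closed: "\<iota> c \<in> L"
    and tau_closed: "\<tau> \<in> L"
begin

lemma emb_closed: "emb f \<in> polys"
  by (simp add: polys_def const_closed)

lemma gen_poly_closed:
  assumes "u \<in> L"
  shows "gen_poly N u \<in> polys"
proof -
  have "(\<phi> ^^ i) u \<in> L" for i
    by (induction i) (use assms in \<open>auto simp: \<phi>_def intro!: add_closed mult_closed tau_closed power_closed\<close>)
  then show ?thesis
    unfolding gen_poly_def
    by (intro polys_sum polys_smult) (auto intro!: polysI const_closed simp: coeff_poly_shift)
qed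

text \<open>Let \<open>g\<close> be the monic gcd of \<open>M\<close> and \<open>emb P\<close> over
  \<open>L\<close>. Modulo \<open>emb P\<close>, \<open>Fr M\<close> equals
  \<open>(X - \<tau>) * M\<close>, so \<open>Fr g\<close> divides \<open>(X - \<tau>) * g\<close>
  and \<open>g\<close> has coefficients in \<open>k\<close>. By irreducibility either
  \<open>g = 1\<close>, or \<open>emb P\<close> divides \<open>M\<close>, which would make
  \<open>u\<close> an \<open>N\<close>-torsion point.\<close>

lemma gen_poly_coprime:
  assumes P: "Factorial_Ring.irreducible P" and "u \<in> L" "act (P * N) u = 0" "act N u \<noteq> 0"
  obtains a b where "a \<in> polys" "b \<in> polys" "a * gen_poly (P * N) u + b * emb P = 1"
proof -
  define M where "M = gen_poly (P * N) u"
  have P0: "P \<noteq> 0" using P by auto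
  obtain a b where ab: "a \<in> polys" "b \<in> polys" and lc: "lead_coeff (a * M + b * emb P) = 1"
    and dvdM: "a * M + b * emb P dvd M" and dvdP: "a * M + b * emb P dvd emb P"
    using polys_bezout[OF gen_poly_closed[OF assms(2)] emb_closed] P0 unfolding M_def
    by (metis map_eq_0_iff)
  define g where "g = a * M + b * emb P"
  have FP: "Fr g dvd emb P"
    using fr.map_dvd[OF dvdP] by (simp add: g_def)
  have "[:- \<tau>, 1:] * M = Fr M + emb P * smult u (emb N)"
    unfolding M_def Fr_gen_poly using assms(3) by (simp add: map_mult)
  moreover have "Fr g dvd Fr M"
    using fr.map_dvd[OF dvdM] by (simp add: g_def)
  ultimately have FM: "Fr g dvd [:- \<tau>, 1:] * M"
    using FP by (metis dvd_add dvd_mult2)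
  have "[:- \<tau>, 1:] * g = a * ([:- \<tau>, 1:] * M) + [:- \<tau>, 1:] * b * emb P"
    by (simp only: g_def) (simp only: algebra_simps)
  then have "Fr g dvd [:- \<tau>, 1:] * g"
    using FM FP by (metis dvd_add dvd_mult)
  \<comment> \<open>A root \<open>\<tau>\<close> of \<open>Fr g\<close> would be a root of
    \<open>emb P\<close>, against transcendence.\<close>
  moreover have "poly (Fr g) \<tau> \<noteq> 0"
    using FP transcendental[OF P0] by (auto simp: dvd_def)
  ultimately have "Fr g = g"
    using lc by (intro Fr_eq_self_if_dvd) (simp_all add: g_def)
  then obtain g0 where g0: "g = emb g0"
    by (rule Fr_fixed)
  have "g0 dvd P"
    using dvdP by (simp add: map_dvd_iff g0 flip: g_def)
  moreover have "\<not> P dvd g0"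
  proof
    assume "P dvd g0"
    then have "emb P dvd M"
      using dvdM map_dvd by (metis dvd_trans g0 g_def)
    then show False
      using act_eq_0_if_dvd_gen_poly[OF P0 assms(3)] assms(4) by (simp add: M_def)
  qed
  ultimately have "is_unit g0"
    using P by (metis dvd_def dvd_refl irreducibleD dvd_mult_unit_iff mult.commute)
  then have "degree g = 0"
    using g0 by (auto elim!: is_unit_polyE)
  then have "g = 1"
    using lc by (auto simp: one_pCons simp flip: g_def elim!: degree_eq_zeroE)
  then show ?thesis
    using that ab by (simp add: g_def M_def)
qed

text \<open>If \<open>a\<close> inverts \<open>M\<close> modulo \<open>emb P\<close>, then
  \<open>1 - a * M\<close> is nilpotent modulo \<open>emb P ^ e\<close>, and a finite geometric
  series lifts the inverse.\<close>

lemma gen_poly_inverse: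
  assumes "Factorial_Ring.irreducible P" "u \<in> L" "act (P * N) u = 0" "act N u \<noteq> 0"
  obtains v where "v \<in> polys" "emb P ^ e dvd 1 - v * gen_poly (P * N) u"
proof -
  define M where "M = gen_poly (P * N) u"
  obtain a b where ab: "a \<in> polys" "b \<in> polys" "a * M + b * emb P = 1"
    using gen_poly_coprime[OF assms] unfolding M_def by metis
  define v where "v = a * (\<Sum>i<e. (1 - a * M) ^ i)"
  have "b * emb P = 1 - a * M"
    using ab(3) by (simp add: algebra_simps)
  then have "(b * emb P) ^ e = (1 - a * M) ^ e"
    by simp
  moreover have "1 - (1 - a * M) ^ e = v * M"
    by (subst one_diff_power_eq) (simp add: v_def algebra_simps)
  ultimately have "1 - v * M = (b * emb P) ^ e"
    by (simp add: algebra_simps)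
  then have "emb P ^ e dvd 1 - v * M"
    by (simp add: power_mult_distrib)
  moreover have "v \<in> polys"
    unfolding v_def M_def using assms(2)
    by (intro polys_mult polys_sum polys_power polys_diff ab gen_poly_closed) auto
  ultimately show ?thesis
    using that M_def by blast
qed

text \<open>
  Differentiating \<open>Fr M \<equiv> (X - \<tau>) * M\<close> logarithmically, with \<open>X\<close>-derivatives, makes the
  multiplicative equation additive: \<open>D = M' / M\<close> satisfies \<open>Fr D - D \<equiv> 1 / (X - \<tau>)\<close>. The
  derivative costs one power of \<open>P\<close>.
\<close>

lemma log_derivative:
  assumes "Factorial_Ring.irreducible P" "u \<in> L" "act (P * P ^ e) u = 0" "act (P ^ e) u \<noteq> 0"
  obtains D where "D \<in> polys" "emb P ^ e dvd [:- \<tau>, 1:] * (Fr D - D) - 1"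
proof -
  define M where "M = gen_poly (P * P ^ e) u"
  define B where "B = emb P ^ e"
  define Y where "Y = [:- \<tau>, 1:]"
  obtain v where v: "v \<in> polys" "B dvd 1 - v * M"
    using gen_poly_inverse[OF assms] unfolding M_def B_def by metis
  have FM: "Fr M = Y * M - smult u (emb P ^ Suc e)"
    unfolding M_def Y_def Fr_gen_poly using assms(3) by (simp add: map_mult map_power)
  then have s1: "B dvd Y * M - Fr M"
    by (simp add: B_def dvd_smult)
  have "Fr (pderiv M) = M + Y * pderiv M - smult u (pderiv (emb P ^ Suc e))"
    by (simp add: fr.map_pderiv FM pderiv_diff pderiv_mult pderiv_smult del: power_Suc)
      (simp add: Y_def pderiv_pCons)
  moreover have "B dvd smult u (pderiv (emb P ^ Suc e))"
    unfolding pderiv_power_Suc B_def by (intro dvd_smult dvd_mult2) simp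
  ultimately have s2: "B dvd Fr (pderiv M) - M - Y * pderiv M"
    by simp
  have "Fr B = B"
    using Fr_emb[of "P ^ e"] by (simp add: B_def map_power)
  then have s3: "B dvd Fr v * Fr M - 1"
    using fr.map_dvd[OF v(2)] by (simp add: fr.map_diff fr.map_mult dvd_diff_commute)
  define D where "D = v * pderiv M"
  define E where "E = Y * (Fr D - D) - 1"
  \<comment> \<open>Multiplication by the square of \<open>M\<close> clears the approximate inverses
    \<open>v\<close> and \<open>Fr v\<close>. The summands are multiples of the differences in
    \<open>s1\<close>, \<open>s3\<close>, \<open>s2\<close> and \<open>v(2)\<close>, in this
    order.\<close>
  have "E * M\<^sup>2 = M * Fr (pderiv M) * Fr v * (Y * M - Fr M) + M * Fr (pderiv M) * (Fr v * Fr M - 1)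
      + M * (Fr (pderiv M) - M - Y * pderiv M) + Y * M * pderiv M * (1 - v * M)"
    unfolding E_def D_def fr.map_mult by (simp add: algebra_simps power2_eq_square)
  also have "B dvd \<dots>"
    using s1 s2 s3 v(2) by (intro dvd_add dvd_mult)
  finally have "B dvd E * M\<^sup>2" .
  \<comment> \<open>The square of \<open>M\<close> is cancelled again, because \<open>v * M\<close>
    is 1 modulo \<open>B\<close>.\<close>
  moreover have "E = E * M\<^sup>2 * v\<^sup>2 + E * (1 + v * M) * (1 - v * M)"
    by (simp add: algebra_simps power2_eq_square)
  ultimately have "B dvd E"
    using v(2) by (metis dvd_add dvd_mult dvd_mult2)
  moreover have "D \<in> polys"
    unfolding D_def M_def by (intro polys_mult v polys_pderiv gen_poly_closed assms)
  ultimately show ?thesis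
    using that by (simp add: B_def E_def Y_def)
qed

text \<open>The linear functional used is the top coefficient modulo \<open>B\<close>. For the
  remainder \<open>r\<close> of \<open>D * Q\<close> and \<open>R = Fr r - r\<close>, the difference
  \<open>(X - \<tau>) * R - Q\<close> is a constant multiple \<open>c0 * B\<close> by degree. The
  coefficient of \<open>X ^ n\<close> gives \<open>c0\<close> as the top coefficient of
  \<open>R\<close>; evaluation at \<open>\<tau>\<close> gives
  \<open>c0 = - Q(\<tau>) / B(\<tau>)\<close>.\<close>

lemma artin_schreier_residue:
  assumes "D \<in> polys" "emb B dvd [:- \<tau>, 1:] * (Fr D - D) - 1" "lead_coeff B = 1"
    and "degree Q < degree B"
  shows "\<exists>w\<in>L. w ^ q - w = poly (emb Q) \<tau> / poly (emb B) \<tau>"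
proof -
  define n where "n = degree B"
  have B0: "B \<noteq> 0" using assms(3) by auto
  define Y where "Y = [:- \<tau>, 1:]"
  define E where "E = Y * (Fr D - D) - 1"
  obtain a r where ar: "a \<in> polys" "r \<in> polys" "D * emb Q = emb B * a + r"
    and "r = 0 \<or> degree r < degree (emb B)"
    using polys_division[OF polys_mult[OF assms(1) emb_closed] emb_closed] B0
    by (metis map_eq_0_iff)
  then have dr: "degree r < n"
    using assms(4) by (auto simp: n_def)
  define R where "R = Fr r - r"
  have dR: "degree R < n"
    unfolding R_def by (rule degree_diff_less) (use dr in auto)
  have "Fr D * emb Q = emb B * Fr a + Fr r"
    using arg_cong[OF ar(3), of Fr] by (simp add: fr.map_mult fr.map_add)
  moreover have "E * emb Q = Y * (Fr D * emb Q - D * emb Q) - emb Q"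
    unfolding E_def by (simp add: algebra_simps power2_eq_square)
  ultimately have "Y * R - emb Q = E * emb Q - emb B * (Y * (Fr a - a))"
    unfolding R_def ar(3) by (simp only: algebra_simps)
  moreover have "emb B dvd E"
    using assms(2) by (simp add: E_def Y_def)
  ultimately have "emb B dvd Y * R - emb Q"
    by simp
  then obtain c where c: "Y * R - emb Q = emb B * c"
    by blast
  have "degree (Y * R) \<le> n"
    using degree_mult_le[of Y R] dR by (simp add: Y_def)
  then have "degree (Y * R - emb Q) \<le> n"
    using assms(4) by (intro degree_diff_le) (simp_all add: n_def)
  then have "degree c = 0"
    using c B0 by (cases "c = 0") (simp_all add: degree_mult_eq n_def)
  then obtain c0 where c0: "c = [:c0:]"
    by (rule degree_eq_zeroE)
  have "poly (Y * R - emb Q) \<tau> = poly (emb B * c) \<tau>"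
    by (simp only: c)
  then have "- poly (emb Q) \<tau> = poly (emb B) \<tau> * c0"
    by (simp add: Y_def c0)
  then have tau: "poly (emb Q) \<tau> = - (poly (emb B) \<tau> * c0)"
    by (metis minus_minus)
  obtain m where m: "n = Suc m"
    using assms(4) n_def by (metis not_less_zero old.nat.exhaust)
  have "coeff (Y * R - emb Q) n = coeff (emb B * c) n"
    by (simp only: c)
  moreover have "coeff R n = 0" "coeff (emb Q) n = 0"
    using dR assms(4) by (simp_all add: coeff_eq_0 n_def)
  moreover have "coeff (emb B) n = 1"
    using assms(3) by (simp add: n_def)
  ultimately have "coeff R m = c0"
    by (simp add: Y_def c0 m)
  then have c0_eq: "c0 = coeff r m ^ q - coeff r m"
    by (simp add: R_def)
  \<comment> \<open>The evaluation produced a minus sign, which additivity of the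
    \<open>q\<close>-th power moves into the solution \<open>- coeff r m\<close>.\<close>
  have "(- coeff r m) ^ q - (- coeff r m) = - c0"
    by (simp add: fr.uminus c0_eq)
  also have "\<dots> = poly (emb Q) \<tau> / poly (emb B) \<tau>"
    using tau transcendental[OF B0] by simp
  finally show ?thesis
    using ar(2) by (intro bexI[of _ "- coeff r m"]) (auto intro: uminus_closed coeff_closed)
qed

text \<open>Phrased with \<open>q\<close> because sums of such \<open>s\<close> are again solvable
  and the torsion points yield solutions of this form; \<open>p\<close>-th powers enter only
  afterwards. The generator \<open>\<tau>\<close> does not occur, so the solutions obtained from
  \<open>T\<close> and from \<open>1/T\<close> can be added.\<close>

definition solvable :: "'a \<Rightarrow> bool" where
  "solvable s \<longleftrightarrow> (\<exists>w\<in>L. w ^ q - w = s)"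

lemma solvable_add: "solvable a \<Longrightarrow> solvable b \<Longrightarrow> solvable (a + b)"
  unfolding solvable_def
proof clarify
  fix v w assume "v \<in> L" "w \<in> L"
  then show "\<exists>z\<in>L. z ^ q - z = v ^ q - v + (w ^ q - w)"
    by (intro bexI[of _ "v + w"]) (auto simp: fr.add intro: add_closed)
qed

lemma solvable_0 [simp]: "solvable 0"
  unfolding solvable_def by (rule bexI[of _ 0]) (use q_ge_2 in auto)

lemma solvable_sum: "(\<And>x. x \<in> A \<Longrightarrow> solvable (f x)) \<Longrightarrow> solvable (sum f A)"
  by (induction A rule: infinite_finite_induct) (auto intro: solvable_add)

lemma solvable_prime_power:
  assumes P: "Factorial_Ring.irreducible P" and tors: "{u. act (P ^ Suc e) u = 0} \<subseteq> L"
    and deg: "degree Q < degree (P ^ e)"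
  shows "solvable (poly (emb Q) \<tau> / poly (emb (P ^ e)) \<tau>)"
proof -
  have P0: "P \<noteq> 0" using P by auto
  then have "degree P > 0"
    using P by (metis gr0I irreducible_not_unit is_unit_iff_degree)
  then obtain u where u: "act (P * P ^ e) u = 0" "act (P ^ e) u \<noteq> 0"
    using exists_torsion_point[of P "P ^ e"] P0 by (metis power_not_zero)
  then have "u \<in> L" using tors by auto
  then obtain D where D: "D \<in> polys" "emb P ^ e dvd [:- \<tau>, 1:] * (Fr D - D) - 1"
    using log_derivative[OF P _ u] by metis
  \<comment> \<open>The residue argument needs a monic denominator; scaling numerator and
    denominator by \<open>l\<close> leaves the fraction unchanged.\<close>
  define l where "l = inverse (lead_coeff (P ^ e))"
  have l0: "l \<noteq> 0" using P0 by (simp add: l_def)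
  have emb_smult: "emb (smult l f) = smult (\<iota> l) (emb f)" for f
    by (rule poly_eqI) (simp add: mult)
  have "\<exists>w\<in>L. w ^ q - w = poly (emb (smult l Q)) \<tau> / poly (emb (smult l (P ^ e))) \<tau>"
  proof (rule artin_schreier_residue[OF D(1)])
    show "emb (smult l (P ^ e)) dvd [:- \<tau>, 1:] * (Fr D - D) - 1"
      using D(2) l0 by (simp add: emb_smult smult_dvd_iff map_power)
    show "lead_coeff (smult l (P ^ e)) = 1"
      using P0 by (simp add: l_def)
    show "degree (smult l Q) < degree (smult l (P ^ e))"
      using deg l0 by simp
  qed
  then show ?thesis
    using l0 by (simp add: solvable_def emb_smult)
qed

end

section \<open>Partial fractions\<close>

lemma irreducible_degree_pos:
  fixes P :: "'a::field poly"
  assumes "Factorial_Ring.irreducible P"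
  shows "degree P > 0"
  using assms by (metis gr0I irreducible_not_unit is_unit_iff_degree irreducible_def)

lemma irreducible_dvd_power:
  fixes P :: "'a::field poly"
  assumes "Factorial_Ring.irreducible P" "P dvd f ^ n"
  shows "P dvd f"
  using field_poly_irreducible_imp_prime[OF assms(1)] assms(2) by (rule prime_elem_dvd_power)

text \<open>A nonconstant divisor of least degree admits no proper factorisation.\<close>

lemma exists_irreducible_factor:
  fixes f :: "'a::field poly"
  assumes "degree f > 0"
  obtains P where "Factorial_Ring.irreducible P" "P dvd f"
proof -
  obtain P where P: "degree P > 0" "P dvd f"
    and min: "\<And>g. degree g > 0 \<Longrightarrow> g dvd f \<Longrightarrow> degree P \<le> degree g"
    using ex_has_least_nat[of "\<lambda>g. degree g > 0 \<and> g dvd f" f degree] assms by auto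
  have "Factorial_Ring.irreducible P"
  proof (rule irreducibleI)
    show "P \<noteq> 0" "\<not> is_unit P"
      using P(1) by (auto elim!: is_unit_polyE)
    fix a b assume ab: "P = a * b"
    then have "a \<noteq> 0" "b \<noteq> 0"
      using P(1) by auto
    then have deg: "degree P = degree a + degree b"
      by (simp add: ab degree_mult_eq)
    have "degree a = 0 \<or> degree P \<le> degree a"
      using min[of a] P(2) ab by (metis dvd_mult_left gr0I)
    then have "degree a = 0 \<or> degree b = 0"
      using deg by auto
    then show "is_unit a \<or> is_unit b"
      using \<open>a \<noteq> 0\<close> \<open>b \<noteq> 0\<close> by (simp add: is_unit_iff_degree)
  qed
  then show ?thesis
    using that P by blast
qed

lemma split_irreducible_power:
  fixes f :: "'a::field poly"
  assumes "f \<noteq> 0" "degree P > 0"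
  obtains n g where "f = P ^ n * g" "\<not> P dvd g"
proof -
  have "\<exists>n g. f = P ^ n * g \<and> \<not> P dvd g"
    using assms(1)
  proof (induction "degree f" arbitrary: f rule: less_induct)
    case less
    show ?case
    proof (cases "P dvd f")
      case True
      then obtain h where h: "f = P * h" by blast
      then have "h \<noteq> 0" "P \<noteq> 0" using less.prems by auto
      then have "degree h < degree f"
        using h assms(2) by (simp add: degree_mult_eq)
      from less.hyps[OF this \<open>h \<noteq> 0\<close>] obtain n g where "h = P ^ n * g" "\<not> P dvd g" by blast
      then show ?thesis
        using h by (intro exI[of _ "Suc n"] exI[of _ g]) (simp add: mult.assoc)
    next
      case False
      then show ?thesis
        by (intro exI[of _ 0] exI[of _ f]) simp
    qed
  qed
  then show ?thesis using that by blast
qed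

text \<open>A nonconstant gcd would have an irreducible factor dividing \<open>P\<close>, hence
  associated to \<open>P\<close>, and then \<open>P\<close> would divide \<open>B\<close>.\<close>

lemma bezout_irreducible_power:
  fixes P :: "'a::field poly"
  assumes "Factorial_Ring.irreducible P" "\<not> P dvd B"
  obtains u v where "u * P ^ e + v * B = 1"
proof -
  interpret U: subfield_set "UNIV :: 'a set"
    by standard auto
  have "B \<noteq> 0" using assms(2) by auto
  have "B \<in> U.polys" "P ^ e \<in> U.polys"
    by (simp_all add: U.polys_def)
  then obtain u v where lc: "lead_coeff (u * P ^ e + v * B) = 1"
    and dvd: "u * P ^ e + v * B dvd P ^ e" "u * P ^ e + v * B dvd B"
    using U.polys_bezout[of "P ^ e" B] \<open>B \<noteq> 0\<close> by blast
  define g where "g = u * P ^ e + v * B"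
  have "degree g = 0"
  proof (rule ccontr)
    assume "degree g \<noteq> 0"
    then obtain R where R: "Factorial_Ring.irreducible R" "R dvd g"
      using exists_irreducible_factor by blast
    have "R dvd P"
      using irreducible_dvd_power[OF R(1)] R(2) dvd(1) g_def dvd_trans by blast
    then have "P dvd R"
      using assms(1) R(1) by (metis irreducibleD' irreducible_not_unit)
    then show False
      using assms(2) R(2) dvd(2) g_def by (metis dvd_trans)
  qed
  then have "g = 1"
    using lc by (auto simp: one_pCons simp flip: g_def elim!: degree_eq_zeroE)
  then show ?thesis
    using that g_def by metis
qed

text \<open>The Bezout identity times \<open>Q\<close> gives a decomposition. Reducing its
  coefficient of \<open>B\<close> modulo \<open>P ^ e\<close> yields \<open>r\<close>; the degree
  bound for \<open>s\<close> then follows from that of \<open>Q - r * B = s * P ^ e\<close>.\<close>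

lemma partial_fraction_step:
  fixes P :: "'a::field poly"
  assumes "Factorial_Ring.irreducible P" "\<not> P dvd B" "degree Q < degree (P ^ e * B)"
  obtains r s where "Q = r * B + s * P ^ e" "r = 0 \<or> degree r < degree (P ^ e)"
    "s = 0 \<or> degree s < degree B"
proof -
  have P0: "P ^ e \<noteq> 0" using assms(1) by auto
  have B0: "B \<noteq> 0" using assms(2) by auto
  obtain u v where uv: "u * P ^ e + v * B = 1"
    using bezout_irreducible_power[OF assms(1,2)] by metis
  define r where "r = (Q * v) mod P ^ e"
  define s where "s = Q * u + (Q * v) div P ^ e * B"
  have "Q = Q * (u * P ^ e + v * B)"
    by (simp only: uv mult_1_right)
  also have "\<dots> = Q * u * P ^ e + ((Q * v) div P ^ e * P ^ e + r) * B"
    unfolding r_def by (simp only: div_mult_mod_eq) (simp add: algebra_simps)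
  also have "\<dots> = r * B + s * P ^ e"
    by (simp add: s_def algebra_simps)
  finally have Q: "Q = r * B + s * P ^ e" .
  have r: "r = 0 \<or> degree r < degree (P ^ e)"
    unfolding r_def using P0 degree_mod_less by blast
  have deg: "degree (P ^ e * B) = degree (P ^ e) + degree B"
    using P0 B0 by (rule degree_mult_eq)
  have "s = 0 \<or> degree s < degree B"
  proof (cases "s = 0")
    case False
    have "r * B = 0 \<or> degree (r * B) < degree (P ^ e * B)"
      using r B0 deg by (cases "r = 0") (simp_all add: degree_mult_eq)
    then have "degree (Q - r * B) < degree (P ^ e * B)"
      using assms(3) by (auto intro: degree_diff_less)
    moreover have "Q - r * B = s * P ^ e"
      using Q by simp
    ultimately have "degree s + degree (P ^ e) < degree (P ^ e * B)"
      using False P0 by (simp add: degree_mult_eq)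
    then show ?thesis using deg by simp
  qed simp
  then show ?thesis
    using that Q r by blast
qed

context carlitz_subfield
begin

text \<open>Induction on the degree of \<open>B\<close>, splitting off the full power of one
  irreducible factor; the torsion hypothesis passes to the cofactor, whose divisors divide
  \<open>B\<close>.\<close>

lemma solvable_fraction:
  assumes "B \<noteq> 0" "degree Q < degree B"
    and "\<And>P e. Factorial_Ring.irreducible P \<Longrightarrow> e > 0 \<Longrightarrow> P ^ e dvd B \<Longrightarrow> {u. act (P ^ Suc e) u = 0} \<subseteq> L"
  shows "solvable (poly (emb Q) \<tau> / poly (emb B) \<tau>)"
  using assms
proof (induction "degree B" arbitrary: B Q rule: less_induct)
  case less
  obtain P where P: "Factorial_Ring.irreducible P" "P dvd B"
    using exists_irreducible_factor[of B] less.prems(2) by auto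
  have dP: "degree P > 0"
    using P(1) by (rule irreducible_degree_pos)
  obtain e C where C: "B = P ^ e * C" "\<not> P dvd C"
    using split_irreducible_power[OF less.prems(1) dP] by metis
  have e: "e > 0"
    using P C by (cases e) auto
  have nz: "C \<noteq> 0" "P ^ e \<noteq> 0"
    using less.prems(1) C by auto
  obtain r s where rs: "Q = r * C + s * P ^ e" "r = 0 \<or> degree r < degree (P ^ e)" "s = 0 \<or> degree s < degree C"
    using partial_fraction_step[OF P(1) C(2)] less.prems(2) C(1) by metis
  have "degree C < degree B"
    using nz e dP by (simp add: C(1) degree_mult_eq degree_power_eq)
  have "solvable (poly (emb s) \<tau> / poly (emb C) \<tau>)"
  proof (cases "s = 0")
    case False
    show ?thesis
      by (rule less.hyps) (use False rs(3) nz C(1) \<open>degree C < degree B\<close> less.prems(3) in auto)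
  qed simp
  moreover have "solvable (poly (emb r) \<tau> / poly (emb (P ^ e)) \<tau>)"
  proof (cases "r = 0")
    case False
    show ?thesis
      by (rule solvable_prime_power[OF P(1)])
        (use False rs(2) less.prems(3)[OF P(1) e] C(1) in auto)
  qed simp
  ultimately have "solvable (poly (emb r) \<tau> / poly (emb (P ^ e)) \<tau> + poly (emb s) \<tau> / poly (emb C) \<tau>)"
    by (intro solvable_add)
  also have "poly (emb r) \<tau> / poly (emb (P ^ e)) \<tau> + poly (emb s) \<tau> / poly (emb C) \<tau>
      = poly (emb Q) \<tau> / poly (emb B) \<tau>"
    using transcendental[OF nz(1)] transcendental[OF nz(2)]
    by (simp add: rs(1) C(1) map_mult map_add add_frac_eq)
  finally show ?case .
qed

section \<open>From \<open>q\<close>-th powers to \<open>p\<close>-th powers\<close>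

lemma frobenius_p: "(x + y :: 'a) ^ p = x ^ p + y ^ p"
  using field_embedding.add[OF frobenius_embedding[of 1]] by simp

lemma frobenius_p_diff: "(x - y :: 'a) ^ p = x ^ p - y ^ p"
  using field_embedding.diff[OF frobenius_embedding[of 1]] by simp

lemma solvable_imp_root:
  assumes "solvable s"
  obtains z where "z \<in> L" "z ^ p - z = s"
proof -
  obtain w where w: "w \<in> L" "w ^ q - w = s"
    using assms by (auto simp: solvable_def)
  \<comment> \<open>The sum over the \<open>p\<close>-power Frobenius turns \<open>z ^ p - z\<close>
    into a telescoping sum from \<open>w\<close> to \<open>w ^ q\<close>.\<close>
  define z where "z = (\<Sum>i<t. w ^ (p ^ i))"
  have "z ^ p = (\<Sum>i<t. (w ^ (p ^ i)) ^ p)"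
    unfolding z_def by (rule freshmans_dream_sum) (simp_all add: CHAR_eq prime_p)
  also have "\<dots> = (\<Sum>i<t. w ^ (p ^ Suc i))"
    by (simp add: mult.commute flip: power_mult)
  finally have "z ^ p - z = (\<Sum>i<t. w ^ (p ^ Suc i) - w ^ (p ^ i))"
    by (simp add: z_def sum_subtractf)
  also have "\<dots> = s"
    by (subst sum_lessThan_telescope) (simp add: w flip: q_def)
  finally show ?thesis
    using that[of z] w(1) by (auto simp: z_def intro!: sum_closed power_closed)
qed

text \<open>Every \<open>p\<close>-power Frobenius moves \<open>z\<close> by an element of
  \<open>k\<close>, so \<open>z ^ q = z + d\<close> with \<open>d\<close> in \<open>k\<close>.
  Raising to the power \<open>q\<close> in total \<open>p\<close> times adds
  \<open>p * d = 0\<close>.\<close>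

lemma const_root_power:
  assumes "z ^ p - z = \<iota> c"
  shows "z ^ (q ^ p) = z"
proof -
  have z: "z ^ p = z + \<iota> c"
    using assms by (simp add: algebra_simps)
  have "\<exists>d. z ^ (p ^ i) = z + \<iota> d" for i
  proof (induction i)
    case 0
    show ?case by (rule exI[of _ 0]) simp
  next
    case (Suc i)
    then obtain d where "z ^ (p ^ i) = z + \<iota> d" by blast
    then have "z ^ (p ^ Suc i) = (z + \<iota> d) ^ p"
      by (metis power_Suc2 power_mult)
    also have "\<dots> = z + \<iota> (c + d ^ p)"
      by (simp add: frobenius_p z add power)
    finally show ?case by blast
  qed
  then obtain d where d: "z ^ q = z + \<iota> d"
    using q_def by metis
  have "z ^ (q ^ n) = z + \<iota> (of_nat n * d)" for n
  proof (induction n)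
    case (Suc n)
    have "z ^ (q ^ Suc n) = (z + \<iota> (of_nat n * d)) ^ q"
      by (metis Suc.IH power_Suc2 power_mult)
    also have "\<dots> = z + \<iota> (of_nat (Suc n) * d)"
      by (simp add: fr.add const_power d add algebra_simps)
    finally show ?case .
  qed simp
  from this[of p] show ?thesis
    by (simp add: of_nat_p_k)
qed

text \<open>A root \<open>w\<close> for \<open>s\<close> lies in \<open>L\<close> and a root
  \<open>z\<close> for the constant lies in \<open>S\<close>, the field of \<open>q ^ p\<close>
  elements. The difference \<open>x = y - z - w\<close> satisfies \<open>x ^ p = x\<close>, hence
  lies in \<open>k\<close>.\<close>

lemma artin_schreier_root_closed:
  assumes "solvable s" "y ^ p - y = s + \<iota> c"
    and "card S = q ^ p" "0 \<in> S" "\<And>x y. x \<in> S \<Longrightarrow> y \<in> S \<Longrightarrow> x * y \<in> S" "S \<subseteq> L"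
  shows "y \<in> L"
proof -
  have p2: "p \<ge> 2"
    using prime_p by (rule prime_ge_2_nat)
  have "q ^ 1 \<le> q ^ p"
    using p2 q_ge_2 by (intro power_increasing) auto
  then have S: "S = {x. x ^ (q ^ p) = x}"
    using assms(3-5) q_ge_2 by (intro powers_eq_self_set) auto
  define f where "f = monom 1 p + [:- \<iota> c, - 1:]"
  have "degree f = p"
    unfolding f_def using p2 by (subst degree_add_eq_left) (auto simp: degree_monom_eq)
  then obtain z where "poly f z = 0"
    using alg_closed_imp_poly_has_root[of f] p2 by auto
  then have "z ^ p - z - \<iota> c = 0"
    by (simp add: f_def poly_monom algebra_simps)
  then have z: "z ^ p - z = \<iota> c"
    by simp
  then have zL: "z \<in> L"
    using const_root_power S assms(6) by auto
  obtain w where w: "w \<in> L" "w ^ p - w = s"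
    using solvable_imp_root[OF assms(1)] .
  define x where "x = y - z - w"
  have "x ^ p - x = (y ^ p - y) - (z ^ p - z) - (w ^ p - w)"
    by (simp add: x_def frobenius_p_diff)
  then have "x ^ p = x"
    by (simp add: assms(2) z w(2))
  then have "x ^ (p ^ i) = x" for i
    by (induction i) (simp_all add: power_mult)
  then have "x \<in> range \<iota>"
    by (simp add: range_const q_def)
  then have "x \<in> L"
    using const_closed by auto
  then have "x + z + w \<in> L"
    using zL w by (intro add_closed)
  then show ?thesis by (simp add: x_def)
qed

end

section \<open>Prime divisors of the rational function field\<close>

definition exponent_of :: "'a::field poly \<Rightarrow> 'a poly \<Rightarrow> nat" where
  "exponent_of P f = (THE n. \<exists>g. f = P ^ n * g \<and> \<not> P dvd g)"

lemma exponent_of_eq: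
  fixes P :: "'a::field poly"
  assumes "P \<noteq> 0" "\<not> P dvd g"
  shows "exponent_of P (P ^ n * g) = n"
  unfolding exponent_of_def
proof (rule the_equality)
  fix m assume "\<exists>h. P ^ n * g = P ^ m * h \<and> \<not> P dvd h"
  then obtain h where h: "P ^ n * g = P ^ m * h" "\<not> P dvd h" by blast
  show "m = n"
  proof (rule linorder_cases[of m n])
    assume "m < n"
    then obtain k where "n = m + Suc k" by (metis less_imp_Suc_add add_Suc_right)
    with h(1) assms(1) have "h = P * (P ^ k * g)" by (simp add: power_add algebra_simps)
    with h(2) show ?thesis by simp
  next
    assume "n < m"
    then obtain k where "m = n + Suc k" by (metis less_imp_Suc_add add_Suc_right)
    with h(1) assms(1) have "g = P * (P ^ k * h)" by (simp add: power_add algebra_simps)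
    with assms(2) show ?thesis by simp
  qed simp
qed (use assms in blast)

context
  fixes P :: "'a::field poly"
  assumes P: "Factorial_Ring.irreducible P"
begin

lemma irreducible_nonzero: "P \<noteq> 0"
  using P by auto

lemma exponent_of_power_self: "exponent_of P (P ^ n) = n"
  using exponent_of_eq[of P 1 n] P irreducible_nonzero by (simp add: irreducible_not_unit)

lemma exponent_ofE:
  assumes "f \<noteq> 0"
  obtains g where "f = P ^ exponent_of P f * g" "\<not> P dvd g"
proof -
  obtain n g where "f = P ^ n * g" "\<not> P dvd g"
    using split_irreducible_power[OF assms irreducible_degree_pos[OF P]] by metis
  then show ?thesis
    using that exponent_of_eq[of P g n] irreducible_nonzero by metis
qed

lemma exponent_of_mult:
  assumes "f \<noteq> 0" "g \<noteq> 0"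
  shows "exponent_of P (f * g) = exponent_of P f + exponent_of P g"
proof -
  obtain f' where f': "f = P ^ exponent_of P f * f'" "\<not> P dvd f'"
    using exponent_ofE[OF assms(1)] .
  obtain g' where g': "g = P ^ exponent_of P g * g'" "\<not> P dvd g'"
    using exponent_ofE[OF assms(2)] .
  have "\<not> P dvd f' * g'"
    using f'(2) g'(2) field_poly_irreducible_imp_prime[OF P] by (simp add: prime_elem_dvd_mult_iff)
  then have "exponent_of P (P ^ (exponent_of P f + exponent_of P g) * (f' * g')) = exponent_of P f + exponent_of P g"
    using P by (intro exponent_of_eq) auto
  also have "P ^ (exponent_of P f + exponent_of P g) * (f' * g')
      = (P ^ exponent_of P f * f') * (P ^ exponent_of P g * g')"
    by (simp add: power_add)
  finally show ?thesis
    by (simp only: f'(1)[symmetric] g'(1)[symmetric])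
qed

lemma power_dvd_iff_le_exponent_of:
  assumes "f \<noteq> 0"
  shows "P ^ n dvd f \<longleftrightarrow> n \<le> exponent_of P f"
proof
  obtain g where g: "f = P ^ exponent_of P f * g" "\<not> P dvd g"
    using exponent_ofE[OF assms] .
  show "P ^ n dvd f" if "n \<le> exponent_of P f"
    using g(1) that by (metis dvd_mult2 le_imp_power_dvd)
  assume "P ^ n dvd f"
  then obtain h where h: "f = P ^ n * h" by blast
  then have "h \<noteq> 0" using assms by auto
  then have "exponent_of P f = exponent_of P (P ^ n) + exponent_of P h"
    using exponent_of_mult[of "P ^ n" h] irreducible_nonzero h by simp
  moreover have "exponent_of P (P ^ n) = n"
    by (rule exponent_of_power_self)
  ultimately show "n \<le> exponent_of P f" by simp
qed

lemma exponent_of_add: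
  assumes "f \<noteq> 0" "g \<noteq> 0" "f + g \<noteq> 0"
  shows "min (exponent_of P f) (exponent_of P g) \<le> exponent_of P (f + g)"
  using assms by (subst power_dvd_iff_le_exponent_of[symmetric])
    (auto intro!: dvd_add simp: power_dvd_iff_le_exponent_of)

end

section \<open>Reduced fractions and the valuations of irreducible polynomials\<close>

lemma ratfun_cases:
  obtains a b where "x = to_fract a / to_fract b" "b \<noteq> (0::'a::idom)"
  by (cases x) (metis Fract_conv_to_fract)

lemma ratfun_reduced:
  fixes x :: "'k::field ratfun"
  obtains a b where "x = to_fract a / to_fract b" "b \<noteq> 0"
    "\<And>P. Factorial_Ring.irreducible P \<Longrightarrow> P dvd b \<Longrightarrow> \<not> P dvd a"
proof -
  define R where "R b \<longleftrightarrow> b \<noteq> 0 \<and> (\<exists>a. x = to_fract a / to_fract b)" for b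
  \<comment> \<open>A denominator of least degree is chosen; a common irreducible factor could be
    cancelled to lower the degree.\<close>
  obtain b0 where "R b0"
    using ratfun_cases[of x] unfolding R_def by metis
  then obtain b where "R b" and least: "\<forall>c. R c \<longrightarrow> degree b \<le> degree c"
    using ex_has_least_nat[of R b0 degree] by blast
  then have b: "b \<noteq> 0" "\<exists>a. x = to_fract a / to_fract b"
    and min: "\<And>c. c \<noteq> 0 \<Longrightarrow> \<exists>a. x = to_fract a / to_fract c \<Longrightarrow> degree b \<le> degree c" for c
    unfolding R_def by blast+
  obtain a where a: "x = to_fract a / to_fract b"
    using b by blast
  have "\<not> P dvd a" if P: "Factorial_Ring.irreducible P" "P dvd b" for P
  proof
    assume "P dvd a"
    then obtain c d where cd: "a = P * c" "b = P * d"
      using P(2) by (auto simp: dvd_def)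
    then have nz: "P \<noteq> 0" "d \<noteq> 0"
      using b by auto
    then have "x = to_fract c / to_fract d"
      by (simp add: a cd)
    then have "degree b \<le> degree d"
      using min nz by blast
    then show False
      using nz irreducible_degree_pos[OF P(1)] by (simp add: cd degree_mult_eq)
  qed
  with a b that show ?thesis by blast
qed

text \<open>The \<open>P\<close>-adic valuation. The description ranges over all representations as
  a fraction, and \<open>padic_eq\<close> shows that they agree. The value at 0 follows the
  convention of \<open>prime_divisors\<close>.\<close>

definition padic :: "'k::field poly \<Rightarrow> 'k valuation" where
  "padic P x = (if x = 0 then 0 else THE n. \<exists>a b. a \<noteq> 0 \<and> b \<noteq> 0 \<and> x = to_fract a / to_fract b \<and>
     n = int (exponent_of P a) - int (exponent_of P b))"

context
  fixes P :: "'k::field poly"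
  assumes P: "Factorial_Ring.irreducible P"
begin

lemma padic_eq:
  assumes "a \<noteq> 0" "b \<noteq> 0"
  shows "padic P (to_fract a / to_fract b) = int (exponent_of P a) - int (exponent_of P b)"
proof -
  have "(THE n. \<exists>c d. c \<noteq> 0 \<and> d \<noteq> 0 \<and> to_fract a / to_fract b = to_fract c / to_fract d \<and>
     n = int (exponent_of P c) - int (exponent_of P d)) = int (exponent_of P a) - int (exponent_of P b)"
  proof (rule the_equality)
    fix n assume "\<exists>c d. c \<noteq> 0 \<and> d \<noteq> 0 \<and> to_fract a / to_fract b = to_fract c / to_fract d \<and>
       n = int (exponent_of P c) - int (exponent_of P d)"
    then obtain c d where cd: "c \<noteq> 0" "d \<noteq> 0" "to_fract a / to_fract b = to_fract c / to_fract d"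
      "n = int (exponent_of P c) - int (exponent_of P d)" by blast
    from cd(1-3) assms have "to_fract (a * d) = to_fract (c * b)"
      by (simp add: divide_simps)
    then have "a * d = c * b"
      by (simp only: to_fract_eq_iff)
    then have "exponent_of P (a * d) = exponent_of P (c * b)"
      by simp
    then show "n = int (exponent_of P a) - int (exponent_of P b)"
      using assms cd by (simp add: exponent_of_mult P)
  qed (use assms in blast)
  then show ?thesis
    using assms by (simp add: padic_def)
qed

lemma padic_poly:
  assumes "f \<noteq> 0"
  shows "padic P (to_fract f) = int (exponent_of P f)"
proof -
  have "exponent_of P 1 = 0"
    using exponent_of_power_self[OF P, of 0] by simp
  then show ?thesis
    using padic_eq[OF assms, of 1] by simp
qed

lemma padic_in_prime_divisors: "padic P \<in> prime_divisors"
proof -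
  have "surj (padic P)"
  proof (rule surjI)
    fix n :: int
    \<comment> \<open>At least one of the exponents \<open>nat n\<close> and
      \<open>nat (- n)\<close> is 0, so the fraction is the \<open>n\<close>-th power of
      \<open>P\<close>.\<close>
    show "padic P (to_fract (P ^ nat n) / to_fract (P ^ nat (- n))) = n"
      using irreducible_nonzero[OF P] by (subst padic_eq) (simp_all add: exponent_of_power_self[OF P])
  qed
  moreover have "padic P (to_fract [:c:]) = 0" for c
  proof (cases "c = 0")
    case False
    then have "\<not> P dvd [:c:]"
      using dvd_imp_degree_le[of P "[:c:]"] irreducible_degree_pos[OF P] by auto
    then show ?thesis
      using exponent_of_eq[of P "[:c:]" 0] irreducible_nonzero[OF P] False by (simp add: padic_poly)
  qed (simp add: padic_def)
  moreover have "padic P (x * y) = padic P x + padic P y" if "x \<noteq> 0" "y \<noteq> 0" for x y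
  proof -
    obtain a b where ab: "x = to_fract a / to_fract b" "b \<noteq> 0" by (rule ratfun_cases)
    obtain c d where cd: "y = to_fract c / to_fract d" "d \<noteq> 0" by (rule ratfun_cases)
    have nz: "a \<noteq> 0" "c \<noteq> 0" using that ab cd by auto
    have "x * y = to_fract (a * c) / to_fract (b * d)"
      by (simp add: ab cd)
    then have "padic P (x * y) = int (exponent_of P (a * c)) - int (exponent_of P (b * d))"
      using ab cd nz by (simp only: padic_eq mult_eq_0_iff simp_thms)
    then show ?thesis
      using ab cd nz by (simp add: padic_eq exponent_of_mult P)
  qed
  moreover have "padic P (x + y) \<ge> min (padic P x) (padic P y)"
    if "x \<noteq> 0" "y \<noteq> 0" "x + y \<noteq> 0" for x y
  proof -
    obtain a b where ab: "x = to_fract a / to_fract b" "b \<noteq> 0" by (rule ratfun_cases)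
    obtain c d where cd: "y = to_fract c / to_fract d" "d \<noteq> 0" by (rule ratfun_cases)
    have nz: "a \<noteq> 0" "c \<noteq> 0" using that ab cd by auto
    have eq: "x + y = to_fract (a * d + c * b) / to_fract (b * d)"
      using ab cd by (simp add: add_frac_eq)
    have "to_fract (a * d + c * b) \<noteq> 0"
      using that(3) unfolding eq by (metis div_0)
    then have nz2: "a * d + c * b \<noteq> 0"
      by (metis to_fract_0)
    have "padic P (x + y) = int (exponent_of P (a * d + c * b)) - int (exponent_of P (b * d))"
      unfolding eq using ab cd nz2 by (intro padic_eq) auto
    moreover have "min (exponent_of P (a * d)) (exponent_of P (c * b)) \<le> exponent_of P (a * d + c * b)"
      using ab cd nz nz2 by (intro exponent_of_add P) auto
    moreover have "padic P x = int (exponent_of P a) - int (exponent_of P b)"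
      "padic P y = int (exponent_of P c) - int (exponent_of P d)"
      using ab cd nz by (simp_all add: padic_eq)
    ultimately show ?thesis
      using ab cd nz by (simp add: exponent_of_mult P min_def split: if_splits)
  qed
  ultimately show ?thesis
    by (simp add: prime_divisors_def padic_def)
qed

end

section \<open>Valuations with a pole at \<open>T\<close>\<close>

lemma to_fract_pCons: "to_fract (pCons c f) = to_fract [:c:] + T_K * to_fract f"
proof -
  have "pCons c f = [:c:] + [:0, 1:] * f"
    by simp
  then show ?thesis
    by (metis T_K_def to_fract_add to_fract_mult)
qed

lemma T_K_nonzero [simp]: "T_K \<noteq> 0"
  by (simp add: T_K_def)

lemma prime_divisor_const: "v \<in> prime_divisors \<Longrightarrow> v (to_fract [:c:]) = 0"
  unfolding prime_divisors_def by blast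

lemma prime_divisor_mult:
  "v \<in> prime_divisors \<Longrightarrow> x \<noteq> 0 \<Longrightarrow> y \<noteq> 0 \<Longrightarrow> v (x * y) = v x + v y"
  unfolding prime_divisors_def by blast

lemma prime_divisor_add:
  "v \<in> prime_divisors \<Longrightarrow> x \<noteq> 0 \<Longrightarrow> y \<noteq> 0 \<Longrightarrow> x + y \<noteq> 0 \<Longrightarrow> min (v x) (v y) \<le> v (x + y)"
  unfolding prime_divisors_def by blast

text \<open>The ultrametric inequality is applied to \<open>d + x\<close> and to
  \<open>x = - d + (d + x)\<close>, where the constant \<open>d\<close> has value 0.\<close>

lemma prime_divisor_add_const:
  assumes v: "v \<in> prime_divisors" and x: "x \<noteq> 0" "v x < 0"
  shows "v (to_fract [:c:] + x) = v x"
proof (cases "c = 0")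
  case False
  define d where "d = to_fract [:c:]"
  have d: "d \<noteq> 0" "v d = 0"
    using False prime_divisor_const[OF v] by (simp_all add: d_def)
  have d': "- d \<noteq> 0" "v (- d) = 0"
    using d prime_divisor_const[OF v, of "- c"] by (simp_all add: d_def flip: to_fract_uminus)
  have nz: "d + x \<noteq> 0"
  proof
    assume "d + x = 0"
    then have "x = - d"
      by (simp add: add_eq_0_iff2)
    then show False using d' x(2) by simp
  qed
  have "min (v d) (v x) \<le> v (d + x)"
    using v d(1) x(1) nz by (rule prime_divisor_add)
  moreover have "min (v (- d)) (v (d + x)) \<le> v (- d + (d + x))"
    using v d'(1) nz by (rule prime_divisor_add) (use x in simp)
  ultimately have "v (d + x) = v x"
    using x(2) d(2) d'(2) by auto
  then show ?thesis by (simp add: d_def)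
qed simp

text \<open>Horner's scheme: the polynomial is \<open>c + T * g\<close>, and the constant
  \<open>c\<close> does not affect the negative value of \<open>T * g\<close>.\<close>

lemma pole_of_T_poly:
  assumes v: "v \<in> prime_divisors" "v T_K < 0" and "f \<noteq> 0"
  shows "v (to_fract f) = int (degree f) * v T_K"
  using assms(3)
proof (induction f)
  case (pCons c g)
  show ?case
  proof (cases "g = 0")
    case False
    define x where "x = T_K * to_fract g"
    have x0: "x \<noteq> 0" using False by (simp add: x_def)
    have "v x = v T_K + v (to_fract g)"
      unfolding x_def using False by (intro prime_divisor_mult v) auto
    then have vx: "v x = int (Suc (degree g)) * v T_K"
      using pCons.IH[OF False] by (simp add: algebra_simps)
    then have "v x < 0"
      using v(2) by (simp add: mult_pos_neg del: of_nat_Suc)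
    then have "v (to_fract [:c:] + x) = v x"
      by (intro prime_divisor_add_const v x0)
    moreover have "degree (pCons c g) = Suc (degree g)"
      using False by simp
    ultimately show ?thesis
      by (simp only: to_fract_pCons[of c g] vx flip: x_def)
  qed (simp add: prime_divisor_const[OF v(1)])
qed simp

lemma pole_of_T_ratfun:
  assumes v: "v \<in> prime_divisors" "v T_K < 0" and "a \<noteq> 0" "b \<noteq> 0"
  shows "v (to_fract a / to_fract b) = (int (degree a) - int (degree b)) * v T_K"
proof -
  have "v (to_fract a / to_fract b * to_fract b) = v (to_fract a / to_fract b) + v (to_fract b)"
    using assms(3,4) by (intro prime_divisor_mult v) auto
  moreover have "to_fract a / to_fract b * to_fract b = to_fract a"
    using assms(4) by simp
  ultimately have "v (to_fract a) = v (to_fract a / to_fract b) + v (to_fract b)"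
    by simp
  then show ?thesis
    by (simp add: pole_of_T_poly[OF v] assms(3,4) algebra_simps)
qed

section \<open>Coefficients of the divisor of \<open>s\<close>\<close>

lemma lookup_minus_sum_single:
  "Poly_Mapping.lookup (D - (\<Sum>i\<in>I. Poly_Mapping.single (f i) (g i))) v
    = Poly_Mapping.lookup D v - (\<Sum>i\<in>I. if f i = v then g i else (0::int))"
proof -
  have "Poly_Mapping.lookup (\<Sum>i\<in>I. Poly_Mapping.single (f i) (g i)) v
      = (\<Sum>i\<in>I. if f i = v then g i else 0)"
    unfolding lookup_sum by (rule sum.cong) (simp_all only: lookup_single when_def)
  then show ?thesis
    by (simp only: lookup_minus)
qed

lemma lookup_minus_sum_single_in:
  assumes "inj_on f I" "finite I" "j \<in> I"
  shows "Poly_Mapping.lookup (D - (\<Sum>i\<in>I. Poly_Mapping.single (f i) (g i))) (f j)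
    = Poly_Mapping.lookup D (f j) - (g j :: int)"
proof -
  have "(\<Sum>i\<in>I. if f i = f j then g i else 0) = (\<Sum>i\<in>I. if i = j then g i else 0)"
    using assms(1,3) by (intro sum.cong refl) (auto simp: inj_on_def)
  then show ?thesis
    unfolding lookup_minus_sum_single using assms(2,3) by simp
qed

lemma lookup_minus_sum_single_notin:
  assumes "v \<notin> f ` I"
  shows "Poly_Mapping.lookup (D - (\<Sum>i\<in>I. Poly_Mapping.single (f i) (g i :: int))) v
    = Poly_Mapping.lookup D v"
proof -
  have "(\<Sum>i\<in>I. if f i = v then g i else 0) = 0"
    using assms by (intro sum.neutral) auto
  then show ?thesis
    unfolding lookup_minus_sum_single by simp
qed

section \<open>Artin--Schreier roots in composites of cyclotomic fields\<close>

definition const_ac :: "'k::field \<Rightarrow> 'k ratfun_ac" where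
  "const_ac c = to_ac (to_fract [:c:])"

lemma const_ac_embedding: "field_embedding const_ac"
proof
  show "const_ac (x + y) = const_ac x + const_ac y" for x y :: 'a
    by (simp add: const_ac_def flip: to_ac_add to_fract_add)
  show "const_ac (x * y) = const_ac x * const_ac y" for x y :: 'a
    by (simp add: const_ac_def flip: to_ac_mult to_fract_mult)
  show "const_ac (1 :: 'a) = 1"
    by (simp add: const_ac_def flip: one_pCons)
qed

lemma poly_at_T: "poly (map_poly const_ac f) (to_ac T_K) = to_ac (to_fract f)"
proof (induction f)
  case (pCons c f)
  have "poly (map_poly const_ac (pCons c f)) (to_ac T_K) = const_ac c + to_ac T_K * to_ac (to_fract f)"
    using pCons by (simp add: map_poly_pCons field_embedding.zero[OF const_ac_embedding])
  also have "\<dots> = to_ac (to_fract [:c:] + T_K * to_fract f)"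
    by (simp add: const_ac_def)
  finally show ?case
    by (simp only: to_fract_pCons[of c f])
qed simp

text \<open>\<open>T ^ degree f\<close> times \<open>f(1/T)\<close> is the reflected polynomial at
  \<open>T\<close>, which is nonzero.\<close>

lemma poly_at_inverse_T_nonzero:
  assumes "f \<noteq> 0"
  shows "poly (map_poly const_ac f) (to_ac (1 / T_K)) \<noteq> 0"
proof -
  interpret field_embedding const_ac
    by (rule const_ac_embedding)
  have reflect: "reflect_poly (map_poly const_ac f) = map_poly const_ac (reflect_poly f)"
    by (rule poly_eqI) (simp add: coeff_reflect_poly)
  have "poly (reflect_poly (map_poly const_ac f)) (to_ac T_K)
      = to_ac T_K ^ degree f * poly (map_poly const_ac f) (inverse (to_ac T_K))"
    by (subst poly_reflect_poly_nz) simp_all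
  moreover have "poly (reflect_poly (map_poly const_ac f)) (to_ac T_K) \<noteq> 0"
    unfolding reflect poly_at_T using assms by simp
  moreover have "to_ac (1 / T_K) = inverse (to_ac T_K)"
    by (simp only: to_ac_divide to_ac_1 inverse_eq_divide)
  ultimately show ?thesis
    by (metis mult_zero_right)
qed

context
  fixes p t :: nat
  assumes prime_p: "Factorial_Ring.prime p" and card_k: "CARD('k::{finite,field}) = p ^ t"
begin

lemma carlitz_module_T: "carlitz_module (const_ac :: 'k \<Rightarrow> _) p t CARD('k) (to_ac T_K)"
  by (intro carlitz_module.intro const_ac_embedding carlitz_module_axioms.intro prime_p card_k refl)
    (simp add: poly_at_T)

lemma carlitz_module_inverse_T: "carlitz_module (const_ac :: 'k \<Rightarrow> _) p t CARD('k) (to_ac (1 / T_K))"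
  by (intro carlitz_module.intro const_ac_embedding carlitz_module_axioms.intro prime_p card_k refl
      poly_at_inverse_T_nonzero)

lemma carlitz_eq_act:
  fixes N :: "'k poly"
  assumes "carlitz_module (const_ac :: 'k \<Rightarrow> _) p t CARD('k) (to_ac \<sigma>)"
  shows "carlitz \<sigma> N u = carlitz_module.act const_ac CARD('k) (to_ac \<sigma>) N u"
proof -
  have "carlitz_module.\<phi> CARD('k) (to_ac \<sigma>) = (\<lambda>w. to_ac \<sigma> * w + w ^ CARD('k))"
    by (rule ext) (simp add: carlitz_module.\<phi>_def[OF assms])
  then show ?thesis
    by (simp add: carlitz_module.act_def[OF assms] carlitz_def const_ac_def)
qed

text \<open>Division gives \<open>a / b = h + r / b\<close>. The proper fraction is treated with
  generator \<open>T\<close>, the monomials of \<open>h\<close> of positive degree with generator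
  \<open>1/T\<close>, and the constant term of \<open>h\<close> with the set
  \<open>S\<close>.\<close>

lemma artin_schreier_root_mem:
  fixes a b :: "'k poly" and L S :: "'k ratfun_ac set"
  assumes L: "subfield_set L" "range to_ac \<subseteq> L"
    and S: "card S = CARD('k) ^ p" "0 \<in> S" "\<And>x y. x \<in> S \<Longrightarrow> y \<in> S \<Longrightarrow> x * y \<in> S" "S \<subseteq> L"
    and b: "b \<noteq> 0" and y: "y ^ p - y = to_ac (to_fract a / to_fract b)"
    and finite_part: "\<And>P e. Factorial_Ring.irreducible P \<Longrightarrow> e > 0 \<Longrightarrow> P ^ e dvd b \<Longrightarrow>
      carlitz_torsion T_K (P ^ Suc e) \<subseteq> L"
    and infinite_part: "\<And>i. 0 < i \<Longrightarrow> i + degree b \<le> degree a \<Longrightarrow>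
      carlitz_torsion (1 / T_K) ([:0, 1:] ^ Suc i) \<subseteq> L"
  shows "y \<in> L"
proof -
  have L_const: "const_ac c \<in> L" for c :: 'k
    using L(2) by (auto simp: const_ac_def)
  have L_ac: "to_ac x \<in> L" for x
    using L(2) by auto
  interpret A: carlitz_subfield const_ac p t "CARD('k)" "to_ac T_K" L
    by (intro carlitz_subfield.intro carlitz_module_T carlitz_subfield_axioms.intro L(1) L_const L_ac)
  interpret B: carlitz_subfield const_ac p t "CARD('k)" "to_ac (1 / T_K)" L
    by (intro carlitz_subfield.intro carlitz_module_inverse_T carlitz_subfield_axioms.intro L(1) L_const L_ac)
  define h where "h = a div b"
  define r where "r = a mod b"
  have proper: "A.solvable (to_ac (to_fract r / to_fract b))"
  proof (cases "r = 0")
    case False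
    have "A.solvable (poly (map_poly const_ac r) (to_ac T_K) / poly (map_poly const_ac b) (to_ac T_K))"
    proof (rule A.solvable_fraction[OF b])
      show "degree r < degree b"
        using False b degree_mod_less[of b a] by (auto simp: r_def)
      show "{u. A.act (P ^ Suc e) u = 0} \<subseteq> L"
        if "Factorial_Ring.irreducible P" "e > 0" "P ^ e dvd b" for P e
        using finite_part[OF that] by (simp add: carlitz_torsion_def carlitz_eq_act[OF carlitz_module_T])
    qed
    then show ?thesis
      by (simp add: poly_at_T)
  qed simp
  have monomial: "A.solvable (const_ac c * to_ac T_K ^ i)" if i: "0 < i" "i \<le> degree h" for c i
  proof -
    \<comment> \<open>A nonconstant quotient forces \<open>degree a = degree b + degree h\<close>,
      which turns the bound on \<open>i\<close> into the one in
      \<open>infinite_part\<close>.\<close>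
    have "degree h > 0"
      using i by simp
    then have bh: "degree (b * h) = degree b + degree h"
      using b by (intro degree_mult_eq) auto
    have "degree r < degree (b * h)"
      using b degree_mod_less[of b a] bh \<open>degree h > 0\<close> by (auto simp: r_def)
    then have "degree (b * h + r) = degree (b * h)"
      by (rule degree_add_eq_left)
    then have "degree h + degree b = degree a"
      using bh by (simp add: h_def r_def)
    then have "carlitz_torsion (1 / T_K) ([:0, 1 :: 'k:] ^ Suc i) \<subseteq> L"
      using i by (intro infinite_part) auto
    then have tors: "{u. B.act ([:0, 1:] ^ Suc i) u = 0} \<subseteq> L"
      by (simp add: carlitz_torsion_def carlitz_eq_act[OF carlitz_module_inverse_T])
    \<comment> \<open>The monomial \<open>c * T ^ i\<close> is the proper fraction
      \<open>c / X ^ i\<close> evaluated at \<open>X = 1/T\<close>.\<close>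
    have "B.solvable (poly (map_poly const_ac [:c:]) (to_ac (1 / T_K)) /
        poly (map_poly const_ac ([:0, 1:] ^ i)) (to_ac (1 / T_K)))"
      by (rule B.solvable_prime_power[OF _ tors])
        (use i in \<open>simp_all add: irreducible_linear_field_poly degree_power_eq\<close>)
    then show ?thesis
      by (simp add: A.map_power map_poly_pCons power_divide divide_simps)
  qed
  have "to_ac (to_fract h) = poly (map_poly const_ac h) (to_ac T_K)"
    by (simp only: poly_at_T)
  also have "\<dots> = (\<Sum>i\<le>degree h. const_ac (coeff h i) * to_ac T_K ^ i)"
    by (simp add: poly_altdef)
  also have "\<dots> = const_ac (coeff h 0) + (\<Sum>i\<in>{0<..degree h}. const_ac (coeff h i) * to_ac T_K ^ i)"
  proof -
    have "{..degree h} = insert 0 {0<..degree h}" by auto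
    then show ?thesis by simp
  qed
  finally have "to_ac (to_fract h) = \<dots>" .
  moreover have "A.solvable (\<Sum>i\<in>{0<..degree h}. const_ac (coeff h i) * to_ac T_K ^ i)"
    by (rule A.solvable_sum) (simp add: monomial)
  ultimately obtain s where s: "A.solvable s" "to_ac (to_fract h) = const_ac (coeff h 0) + s"
    by blast
  have "to_fract a = to_fract b * to_fract h + to_fract r"
    by (simp add: h_def r_def flip: to_fract_mult to_fract_add)
  then have "to_fract a / to_fract b = to_fract h + to_fract r / to_fract b"
    using b by (simp add: field_simps)
  then have "y ^ p - y = (s + to_ac (to_fract r / to_fract b)) + const_ac (coeff h 0)"
    using y s(2) by (simp add: algebra_simps)
  moreover have "A.solvable (s + to_ac (to_fract r / to_fract b))"
    using s(1) proper by (rule A.solvable_add)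
  ultimately show ?thesis
    using A.artin_schreier_root_closed[OF _ _ S] by blast
qed

lemma carlitz_torsion_mono_T:
  "M dvd N \<Longrightarrow> carlitz_torsion T_K M \<subseteq> carlitz_torsion T_K (N :: 'k poly)"
  using carlitz_module.act_dvd[OF carlitz_module_T]
  by (auto simp: carlitz_torsion_def carlitz_eq_act[OF carlitz_module_T])

lemma carlitz_torsion_mono_inverse_T:
  "M dvd N \<Longrightarrow> carlitz_torsion (1 / T_K) M \<subseteq> carlitz_torsion (1 / T_K) (N :: 'k poly)"
  using carlitz_module.act_dvd[OF carlitz_module_inverse_T]
  by (auto simp: carlitz_torsion_def carlitz_eq_act[OF carlitz_module_inverse_T])

end

section \<open>Generated subfields of the algebraic closure\<close>

lemma K_bar_simps:
  "carrier K_bar = UNIV" "\<zero>\<^bsub>K_bar\<^esub> = 0" "\<one>\<^bsub>K_bar\<^esub> = 1"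
  "x \<otimes>\<^bsub>K_bar\<^esub> y = x * y" "x \<oplus>\<^bsub>K_bar\<^esub> y = x + y"
  by (simp_all add: ring_of_type_algebra_def)

lemma subfield_K_bar_mult_closed:
  assumes "subfield S K_bar" "x \<in> S" "y \<in> S"
  shows "x * y \<in> S"
  using subringE(6)[OF subfieldE(1)[OF assms(1)] assms(2,3)] by (simp add: K_bar_simps)

lemma subfield_K_bar_zero: "subfield S K_bar \<Longrightarrow> 0 \<in> S"
  using subringE(2)[OF subfieldE(1)] by (metis K_bar_simps(2))

lemma subfield_set_generate_field: "subfield_set (generate_field K_bar H)"
proof -
  interpret R: field K_bar
    by (rule field_from_type_algebra)
  have neg: "\<ominus>\<^bsub>K_bar\<^esub> x = - x" for x
    by (rule R.minus_equality) (simp_all add: K_bar_simps)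
  have inv: "inv\<^bsub>K_bar\<^esub> x = inverse x" if "x \<noteq> 0" for x
    by (rule R.comm_inv_char) (use that in \<open>simp_all add: K_bar_simps\<close>)
  show ?thesis
  proof
    show "1 \<in> generate_field K_bar H"
      using generate_field.one[of K_bar H] by (simp add: K_bar_simps)
    fix x y assume xy: "x \<in> generate_field K_bar H" "y \<in> generate_field K_bar H"
    show "x + y \<in> generate_field K_bar H"
      using generate_field.eng_add[OF xy] by (simp add: K_bar_simps)
    show "x * y \<in> generate_field K_bar H"
      using generate_field.eng_mult[OF xy] by (simp add: K_bar_simps)
  next
    fix x assume x: "x \<in> generate_field K_bar H"
    show "- x \<in> generate_field K_bar H"
      using generate_field.a_inv[OF x] by (simp add: neg)
    show "inverse x \<in> generate_field K_bar H"
    proof (cases "x = 0")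
      case False
      then show ?thesis
        using generate_field.m_inv[OF x] by (simp add: K_bar_simps inv)
    qed (use x in simp)
  qed
qed

lemma generate_field_subset:
  assumes "H \<subseteq> generate_field K_bar G"
  shows "generate_field K_bar H \<subseteq> generate_field K_bar G"
proof -
  interpret R: field K_bar
    by (rule field_from_type_algebra)
  show ?thesis
    using assms by (intro R.generate_field_min_subfield1 R.generate_field_is_subfield) (simp_all add: K_bar_simps)
qed

lemma composite_upper: "E \<subseteq> composite E F" "F \<subseteq> composite E F"
  by (auto simp: composite_def intro: generate_field.incl)

lemma cyclotomic_upper: "range to_ac \<subseteq> cyclotomic \<sigma> N" "carlitz_torsion \<sigma> N \<subseteq> cyclotomic \<sigma> N"
  by (auto simp: cyclotomic_def adjoin_def intro: generate_field.incl)

theorem theorem2p11: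
  fixes p t r :: nat
    and s :: "'k::{finite,field} ratfun"
    and y :: "'k ratfun_ac"
    and F Fqp :: "'k ratfun_ac set"
    and \<P>inf :: "'k valuation"
    and \<P> :: "nat \<Rightarrow> 'k valuation"
    and \<alpha> :: "nat \<Rightarrow> nat"
    and \<CC> :: "'k divisor"
    and P :: "nat \<Rightarrow> 'k poly"
  assumes "Factorial_Ring.prime p" and "t \<ge> 1" and "CARD('k) = p ^ t"
    and "\<P>inf \<in> prime_divisors" and "\<P>inf T_K < 0"
    and "subfield Fqp K_bar" and "card Fqp = CARD('k) ^ p"
    and "s \<notin> wp p"
    and "y ^ p - y = to_ac s"
    and "F = adjoin {y}"
    and "\<And>i. i \<in> {1..r} \<Longrightarrow> \<P> i \<in> prime_divisors"
    and "inj_on \<P> {1..r}"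
    and "\<And>i. i \<in> {1..r} \<Longrightarrow> \<alpha> i \<ge> 1"
    and "\<And>i. i \<in> {1..r} \<Longrightarrow> coprime (\<alpha> i) p"
    and "integral_divisor \<CC>"
    and "\<And>i. i \<in> {1..r} \<Longrightarrow> Poly_Mapping.lookup \<CC> (\<P> i) = 0"
    and "has_divisor s (\<CC> - (\<Sum>i=1..r. Poly_Mapping.single (\<P> i) (int (\<alpha> i))))"
    and "\<And>i. i \<in> {1..r} \<Longrightarrow> \<P> i \<noteq> \<P>inf \<Longrightarrow> corresponds (P i) (\<P> i)"
  shows "(\<P>inf \<notin> \<P> ` {1..r} \<longrightarrow>
            F \<subseteq> composite (cyclotomic T_K (\<Prod>i=1..r. P i ^ (\<alpha> i + 1))) Fqp) \<and>
         (r \<ge> 1 \<and> \<P> 1 = \<P>inf \<longrightarrow>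
            F \<subseteq> composite (composite (cyclotomic (1 / T_K) (Polynomial.monom 1 (\<alpha> 1 + 1)))
                                     (cyclotomic T_K (\<Prod>i=2..r. P i ^ (\<alpha> i + 1)))) Fqp)"
proof -
  note inf = assms(4,5)
  obtain a b where ab: "s = to_fract a / to_fract b" "b \<noteq> 0"
    and red: "\<And>Q. Factorial_Ring.irreducible Q \<Longrightarrow> Q dvd b \<Longrightarrow> \<not> Q dvd a"
    using ratfun_reduced[of s] by blast
  have "s \<noteq> 0"
    using assms(17) by (simp add: has_divisor_def)
  then have a0: "a \<noteq> 0"
    using ab by auto
  have at_pole: "v s = - int (\<alpha> i)" if "i \<in> {1..r}" "v = \<P> i" for v i
  proof -
    have "v s = Poly_Mapping.lookup (\<CC> - (\<Sum>i=1..r. Poly_Mapping.single (\<P> i) (int (\<alpha> i)))) (\<P> i)"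
      using assms(17) assms(11)[OF that(1)] that(2) unfolding has_divisor_def by metis
    then show ?thesis
      using assms(16)[OF that(1)] that(1)
      by (simp only: lookup_minus_sum_single_in[OF assms(12) finite_atLeastAtMost] diff_0)
  qed
  have no_pole: "v s \<ge> 0" if "v \<in> prime_divisors" "v \<notin> \<P> ` {1..r}" for v
  proof -
    have "v s = Poly_Mapping.lookup (\<CC> - (\<Sum>i=1..r. Poly_Mapping.single (\<P> i) (int (\<alpha> i)))) v"
      using assms(17) that(1) unfolding has_divisor_def by metis
    then show ?thesis
      using assms(15) by (simp only: lookup_minus_sum_single_notin[OF that(2)] integral_divisor_def)
  qed
  \<comment> \<open>If \<open>Q ^ e\<close> divides the reduced denominator, the
    \<open>Q\<close>-adic value of \<open>s\<close> is at most \<open>- e\<close>. A negative value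
    occurs only at some \<open>\<P> i\<close>, where it is \<open>- \<alpha> i\<close>; hence
    \<open>e \<le> \<alpha> i\<close>.\<close>
  have pole: "\<exists>i\<in>{1..r}. \<P> i \<noteq> \<P>inf \<and> e \<le> \<alpha> i \<and> Q dvd P i"
    if Q: "Factorial_Ring.irreducible Q" and e: "e > 0" "Q ^ e dvd b" for Q e
  proof -
    have mb: "e \<le> exponent_of Q b"
      using e(2) ab(2) by (simp add: power_dvd_iff_le_exponent_of[OF Q])
    have "Q dvd b"
      using e by (metis dvd_power dvd_trans)
    then have "exponent_of Q a = 0"
      using red[OF Q] power_dvd_iff_le_exponent_of[OF Q a0, of 1] by simp
    then have val: "padic Q s = - int (exponent_of Q b)"
      using padic_eq[OF Q a0 ab(2)] ab(1) by simp
    then have "\<not> padic Q s \<ge> 0"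
      using mb e(1) by simp
    then obtain i where i: "i \<in> {1..r}" "padic Q = \<P> i"
      using no_pole[OF padic_in_prime_divisors[OF Q]] by blast
    \<comment> \<open>The polynomial \<open>T\<close> has no pole at \<open>Q\<close>, which
      separates this prime divisor from \<open>\<P>inf\<close>.\<close>
    have "padic Q T_K \<ge> 0"
      using padic_poly[OF Q, of "[:0, 1:]"] by (simp add: T_K_def)
    then have "\<P> i \<noteq> \<P>inf"
      using i(2) inf(2) by auto
    moreover have "e \<le> \<alpha> i"
      using mb val at_pole[OF i] by simp
    moreover have "Q dvd P i"
    proof -
      have Pi: "P i \<noteq> 0" "padic Q (to_fract (P i)) > 0"
        using assms(18)[OF i(1) \<open>\<P> i \<noteq> \<P>inf\<close>] i(2) by (auto simp: corresponds_def)
      then have "Q ^ 1 dvd P i"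
        by (subst power_dvd_iff_le_exponent_of[OF Q Pi(1)]) (simp add: padic_poly[OF Q Pi(1)])
      then show ?thesis by simp
    qed
    ultimately show ?thesis using i by blast
  qed
  have inf_s: "\<P>inf s = (int (degree a) - int (degree b)) * \<P>inf T_K"
    unfolding ab(1) by (rule pole_of_T_ratfun[OF inf a0 ab(2)])
  have tors: "carlitz_torsion T_K (Q ^ Suc e) \<subseteq> carlitz_torsion T_K (\<Prod>i\<in>I. P i ^ (\<alpha> i + 1))"
    if "i \<in> I" "finite I" "e \<le> \<alpha> i" "Q dvd P i" for Q e i and I :: "nat set"
  proof (rule carlitz_torsion_mono_T[OF assms(1,3)])
    have "Q ^ Suc e dvd P i ^ (\<alpha> i + 1)"
      using that by (intro dvd_power_le) auto
    also have "\<dots> dvd (\<Prod>i\<in>I. P i ^ (\<alpha> i + 1))"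
      using that by (intro dvd_prodI)
    finally show "Q ^ Suc e dvd (\<Prod>i\<in>I. P i ^ (\<alpha> i + 1))" .
  qed
  have F_subset: "F \<subseteq> composite E Fqp" if "range to_ac \<subseteq> E" "y \<in> composite E Fqp" for E
    using that composite_upper(1)[of E Fqp] unfolding assms(10) adjoin_def composite_def
    by (intro generate_field_subset) blast
  have root: "y \<in> composite E Fqp"
    if E: "range to_ac \<subseteq> E"
      and fin: "\<And>Q e. Factorial_Ring.irreducible Q \<Longrightarrow> e > 0 \<Longrightarrow> Q ^ e dvd b \<Longrightarrow> carlitz_torsion T_K (Q ^ Suc e) \<subseteq> E"
      and infin: "\<And>i. 0 < i \<Longrightarrow> i + degree b \<le> degree a \<Longrightarrow> carlitz_torsion (1 / T_K) ([:0, 1:] ^ Suc i) \<subseteq> E" for E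
  proof (rule artin_schreier_root_mem[OF assms(1,3) _ _ assms(7)])
    show "subfield_set (composite E Fqp)"
      unfolding composite_def by (rule subfield_set_generate_field)
    show "range to_ac \<subseteq> composite E Fqp" "Fqp \<subseteq> composite E Fqp"
      using E composite_upper[of E Fqp] composite_upper(2)[of Fqp E] by auto
    show "0 \<in> Fqp" "\<And>x y. x \<in> Fqp \<Longrightarrow> y \<in> Fqp \<Longrightarrow> x * y \<in> Fqp"
      using subfield_K_bar_zero[OF assms(6)] subfield_K_bar_mult_closed[OF assms(6)] by auto
    show "b \<noteq> 0" "y ^ p - y = to_ac (to_fract a / to_fract b)"
      using ab assms(9) by simp_all
    show "carlitz_torsion T_K (Q ^ Suc e) \<subseteq> composite E Fqp"
      if "Factorial_Ring.irreducible Q" "e > 0" "Q ^ e dvd b" for Q e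
      using fin[OF that] composite_upper(1) by blast
    show "carlitz_torsion (1 / T_K) ([:0, 1:] ^ Suc i) \<subseteq> composite E Fqp"
      if "0 < i" "i + degree b \<le> degree a" for i
      using infin[OF that] composite_upper(1) by blast
  qed
  show ?thesis
  proof (intro conjI impI)
    assume "\<P>inf \<notin> \<P> ` {1..r}"
    then have "\<P>inf s \<ge> 0"
      using no_pole inf(1) by blast
    \<comment> \<open>Without a pole at infinity no monomial of positive degree occurs, so the
      condition on \<open>1/T\<close>-torsion is vacuous.\<close>
    then have deg: "degree a \<le> degree b"
      using inf(2) by (simp add: inf_s zero_le_mult_iff)
    show "F \<subseteq> composite (cyclotomic T_K (\<Prod>i=1..r. P i ^ (\<alpha> i + 1))) Fqp"
    proof (intro F_subset root cyclotomic_upper(1))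
      show "carlitz_torsion T_K (Q ^ Suc e) \<subseteq> cyclotomic T_K (\<Prod>i=1..r. P i ^ (\<alpha> i + 1))"
        if "Factorial_Ring.irreducible Q" "e > 0" "Q ^ e dvd b" for Q e
        using pole[OF that] tors[of _ "{1..r}"] cyclotomic_upper(2) by blast
    qed (use deg in auto)
  next
    assume r: "r \<ge> 1 \<and> \<P> 1 = \<P>inf"
    define d where "d = int (degree a) - int (degree b)"
    have "d * \<P>inf T_K = - int (\<alpha> 1)"
      using at_pole[of 1 \<P>inf] r inf_s by (simp add: d_def)
    moreover have "\<P>inf T_K \<le> - 1"
      using inf(2) by simp
    \<comment> \<open>From \<open>d * \<P>inf T_K = - \<alpha> 1\<close> and
      \<open>\<P>inf T_K \<le> - 1\<close>: the polynomial part of \<open>s\<close> has degree at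
      most \<open>\<alpha> 1\<close>.\<close>
    ultimately have deg: "d \<le> int (\<alpha> 1)"
      by (cases "d \<ge> 0") (use mult_left_mono[of "\<P>inf T_K" "- 1" d] in auto)
    let ?E1 = "cyclotomic (1 / T_K) (Polynomial.monom 1 (\<alpha> 1 + 1)) :: 'k ratfun_ac set"
    let ?E2 = "cyclotomic T_K (\<Prod>i=2..r. P i ^ (\<alpha> i + 1))"
    have base: "range to_ac \<subseteq> composite ?E1 ?E2"
      using cyclotomic_upper(1) composite_upper(1) by (rule order_trans)
    show "F \<subseteq> composite (composite ?E1 ?E2) Fqp"
    proof (intro F_subset root base)
      show "carlitz_torsion T_K (Q ^ Suc e) \<subseteq> composite ?E1 ?E2"
        if Q: "Factorial_Ring.irreducible Q" "e > 0" "Q ^ e dvd b" for Q e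
      proof -
        obtain i where i: "i \<in> {1..r}" "\<P> i \<noteq> \<P>inf" "e \<le> \<alpha> i" "Q dvd P i"
          using pole[OF Q] by blast
        then have "i \<noteq> 1"
          using r by auto
        then have "i \<in> {2..r}"
          using i(1) by auto
        then have "carlitz_torsion T_K (Q ^ Suc e) \<subseteq> ?E2"
          using tors[of i "{2..r}"] i cyclotomic_upper(2) by blast
        then show ?thesis
          using composite_upper(2) by blast
      qed
      show "carlitz_torsion (1 / T_K) ([:0, 1:] ^ Suc i) \<subseteq> composite ?E1 ?E2"
        if "0 < i" "i + degree b \<le> degree a" for i
      proof -
        have "i \<le> \<alpha> 1"
          using that deg by (simp add: d_def)
        then have "[:0, 1:] ^ Suc i dvd (Polynomial.monom 1 (\<alpha> 1 + 1) :: 'k poly)"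
          by (simp add: monom_altdef le_imp_power_dvd del: power_Suc)
        then have "carlitz_torsion (1 / T_K) ([:0, 1:] ^ Suc i) \<subseteq> ?E1"
          using carlitz_torsion_mono_inverse_T[OF assms(1,3)] cyclotomic_upper(2) by blast
        then show ?thesis
          using composite_upper(1) by blast
      qed
    qed
  qed
qed

end
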